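(* For any $\Lambda_V$-terms $M,N$, if $\langle M\rangle\simeq_A\langle N\rangle$, then for any $\Lambda_V$ context $C$, $\langle C[M]\rangle\simeq_A\langle C[N]\rangle$.
   Context: Call-by-value $\lambda$-calculus $\Lambda_V$: values $V ::= x \mid \lambda x.M$, terms $M,N ::= V \mid MN$, evaluation contexts $E ::= [\cdot] \mid VE \mid EM$, general contexts $C ::= [\cdot]\mid\lambda x.C\mid MC\mid CM$; reduction $\to_v$ is the least relation with $(\lambda x.M)V \to_v M\{V/x\}$ and $E[M]\to_v E[N]$ whenever $M\to_v N$. Names: variables $x,y,z,\ldots$ and continuation names $p,q,r,\ldots$ (disjoint). An environment $\gamma$ is a finite partial map sending variables to values and continuation names to pairs $(E,q)$; $\cdot$ is union with disjoint domains; $\uplus$ is disjoint union. Alternating OGS (AOGS): configurations are active $\langle M,p,\gamma,\phi\rangle$, passive $\langle\gamma,\phi\rangle$, or initial $\langle M\rangle_\phi$, $\phi$ a finite set of names; $\langle M\rangle$ denotes $\langle M\rangle_\phi$ with $\phi$ the set of free variables of $M$. LTS $\to_A$: (P$\tau$) $\langle M,p,\gamma,\phi\rangle\xrightarrow{\tau}_A\langle N,p,\gamma,\phi\rangle$ if $M\to_v N$; (PA) $\langle V,p,\gamma,\phi\rangle\xrightarrow{\overline p(x)}_A\langle\gamma\cdot[x\mapsto V],\phi\uplus\{x\}\rangle$; (PQ) $\langle E[xV],p,\gamma,\phi\rangle\xrightarrow{\overline x(y,q)}_A\langle\gamma\cdot[y\mapsto V]\cdot[q\mapsto(E,p)],\phi\uplus\{y,q\}\rangle$;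 (OA) $\langle\gamma\cdot[q\mapsto(E,p)],\phi\rangle\xrightarrow{q(x)}_A\langle E[x],p,\gamma,\phi\uplus\{x\}\rangle$; (OQ) $\langle\gamma,\phi\rangle\xrightarrow{x(y,p)}_A\langle Vy,p,\gamma,\phi\uplus\{y,p\}\rangle$ if $\gamma(x)=V$; (IOQ) $\langle M\rangle_\phi\xrightarrow{(p)}_A\langle M,p,\emptyset,\phi\uplus\{p\}\rangle$. A trace is a finite sequence of non-$\tau$ actions, performed with any number of interleaved $\tau$ steps (bound names fresh); $\simeq_A$ is trace equivalence (having the same traces) on this LTS. *)

theory Defs
  imports Main
begin

type_synonym var = nat
type_synonym cname = nat

datatype name = VName var | CName cname

text \<open>
  Terms up to renaming of bound variables, in locally nameless style: free variables are named,
  bound variables are de Bruijn indices. The terms of the calculus are the locally closed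
  elements of \<open>trm\<close>, i.e. those satisfying \<open>lc\<close>.
\<close>

datatype trm = FVar var | BVar nat | App trm trm | Lam trm

primrec lc_at :: "nat \<Rightarrow> trm \<Rightarrow> bool" where
  "lc_at k (FVar x) = True"
| "lc_at k (BVar i) = (i < k)"
| "lc_at k (App M N) = (lc_at k M \<and> lc_at k N)"
| "lc_at k (Lam M) = lc_at (Suc k) M"

abbreviation lc :: "trm \<Rightarrow> bool" where
  "lc M \<equiv> lc_at 0 M"

primrec fv :: "trm \<Rightarrow> var set" where
  "fv (FVar x) = {x}"
| "fv (BVar i) = {}"
| "fv (App M N) = fv M \<union> fv N"
| "fv (Lam M) = fv M"

primrec open_at :: "nat \<Rightarrow> trm \<Rightarrow> trm \<Rightarrow> trm" where
  "open_at k V (FVar x) = FVar x"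
| "open_at k V (BVar i) = (if i = k then V else BVar i)"
| "open_at k V (App M N) = App (open_at k V M) (open_at k V N)"
| "open_at k V (Lam M) = Lam (open_at (Suc k) V M)"

primrec close_at :: "nat \<Rightarrow> var \<Rightarrow> trm \<Rightarrow> trm" where
  "close_at k x (FVar y) = (if y = x then BVar k else FVar y)"
| "close_at k x (BVar i) = BVar i"
| "close_at k x (App M N) = App (close_at k x M) (close_at k x N)"
| "close_at k x (Lam M) = Lam (close_at (Suc k) x M)"

text \<open>The named abstraction \<open>\<lambda>x. M\<close>, binding the free occurrences of \<open>x\<close> in \<open>M\<close>.\<close>

definition lam :: "var \<Rightarrow> trm \<Rightarrow> trm" where
  "lam x M = Lam (close_at 0 x M)"

primrec subst :: "trm \<Rightarrow> var \<Rightarrow> trm \<Rightarrow> trm" where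
  "subst (FVar y) x V = (if y = x then V else FVar y)"
| "subst (BVar i) x V = BVar i"
| "subst (App M N) x V = App (subst M x V) (subst N x V)"
| "subst (Lam M) x V = Lam (subst M x V)"

primrec is_value :: "trm \<Rightarrow> bool" where
  "is_value (FVar x) = True"
| "is_value (BVar i) = False"
| "is_value (App M N) = False"
| "is_value (Lam M) = True"

datatype ectx = EHole | EArg trm ectx | EFun ectx trm

primrec plug :: "ectx \<Rightarrow> trm \<Rightarrow> trm" where
  "plug EHole M = M"
| "plug (EArg V E) M = App V (plug E M)"
| "plug (EFun E N) M = App (plug E M) N"

primrec is_ectx :: "ectx \<Rightarrow> bool" where
  "is_ectx EHole = True"
| "is_ectx (EArg V E) = (is_value V \<and> is_ectx E)"
| "is_ectx (EFun E N) = is_ectx E"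

datatype ctx = CHole | CLam var ctx | CArg trm ctx | CFun ctx trm

text \<open>Filling may capture: \<open>CLam x C\<close> binds the free occurrences of \<open>x\<close> in the inserted term.\<close>

primrec fill :: "ctx \<Rightarrow> trm \<Rightarrow> trm" where
  "fill CHole M = M"
| "fill (CLam x C) M = lam x (fill C M)"
| "fill (CArg N C) M = App N (fill C M)"
| "fill (CFun C N) M = App (fill C M) N"

primrec lc_ctx :: "ctx \<Rightarrow> bool" where
  "lc_ctx CHole = True"
| "lc_ctx (CLam x C) = lc_ctx C"
| "lc_ctx (CArg N C) = (lc N \<and> lc_ctx C)"
| "lc_ctx (CFun C N) = (lc_ctx C \<and> lc N)"

inductive step :: "trm \<Rightarrow> trm \<Rightarrow> bool" (infix "\<rightarrow>\<^sub>v" 50) where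
  beta: "is_value V \<Longrightarrow> App (Lam M) V \<rightarrow>\<^sub>v open_at 0 V M"
| ectx: "M \<rightarrow>\<^sub>v N \<Longrightarrow> is_ectx E \<Longrightarrow> plug E M \<rightarrow>\<^sub>v plug E N"

lemma open_close_at:
  assumes "lc_at k M"
  shows "open_at k V (close_at k x M) = subst M x V"
  using assms by (induction M arbitrary: k) auto

text \<open>Rule \<open>beta\<close> is stated by opening; it agrees with \<open>(\<lambda>x. M) V \<rightarrow> M{V/x}\<close>.\<close>

lemma beta_lam:
  assumes "lc M" and "is_value V"
  shows "App (lam x M) V \<rightarrow>\<^sub>v subst M x V"
  using step.beta[OF assms(2), of "close_at 0 x M"] open_close_at[OF assms(1)]
  by (simp add: lam_def)

datatype entry = Val trm | Cont ectx cname

type_synonym env = "name \<Rightarrow> entry option"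

text \<open>
  No finiteness or sorting condition is imposed on environments and name sets. Every
  configuration reachable from an initial one with a locally closed term and a finite name set
  has a finite name set and a finite environment sending variables to values and continuation
  names to pairs of an evaluation context and a continuation name.
\<close>

datatype config =
    Active trm cname env "name set"
  | Passive env "name set"
  | Initial trm "name set"

datatype action =
    Tau
  | PAns cname var       \<comment> \<open>\<open>p(x)\<close>, output\<close>
  | PQue var var cname   \<comment> \<open>\<open>x(y,q)\<close>, output\<close>
  | OAns cname var       \<comment> \<open>\<open>q(x)\<close>, input\<close>
  | OQue var var cname   \<comment> \<open>\<open>x(y,p)\<close>, input\<close>
  | IOQue cname          \<comment> \<open>\<open>(p)\<close>\<close>

inductive aogs :: "config \<Rightarrow> action \<Rightarrow> config \<Rightarrow> bool" where
  P_tau: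
    "M \<rightarrow>\<^sub>v N \<Longrightarrow> aogs (Active M p \<gamma> \<phi>) Tau (Active N p \<gamma> \<phi>)"
| PA:
    "is_value V \<Longrightarrow> VName x \<notin> \<phi> \<Longrightarrow> VName x \<notin> dom \<gamma> \<Longrightarrow>
     aogs (Active V p \<gamma> \<phi>) (PAns p x)
          (Passive (\<gamma>(VName x \<mapsto> Val V)) (\<phi> \<union> {VName x}))"
| PQ:
    "is_ectx E \<Longrightarrow> is_value V \<Longrightarrow>
     {VName y, CName q} \<inter> \<phi> = {} \<Longrightarrow> {VName y, CName q} \<inter> dom \<gamma> = {} \<Longrightarrow>
     aogs (Active (plug E (App (FVar x) V)) p \<gamma> \<phi>) (PQue x y q)
          (Passive (\<gamma>(VName y \<mapsto> Val V, CName q \<mapsto> Cont E p)) (\<phi> \<union> {VName y, CName q}))"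
| OA:
    "CName q \<notin> dom \<gamma> \<Longrightarrow> VName x \<notin> \<phi> \<Longrightarrow>
     aogs (Passive (\<gamma>(CName q \<mapsto> Cont E p)) \<phi>) (OAns q x)
          (Active (plug E (FVar x)) p \<gamma> (\<phi> \<union> {VName x}))"
| OQ:
    "\<gamma> (VName x) = Some (Val V) \<Longrightarrow> {VName y, CName p} \<inter> \<phi> = {} \<Longrightarrow>
     aogs (Passive \<gamma> \<phi>) (OQue x y p)
          (Active (App V (FVar y)) p \<gamma> (\<phi> \<union> {VName y, CName p}))"
| IOQ:
    "CName p \<notin> \<phi> \<Longrightarrow>
     aogs (Initial M \<phi>) (IOQue p) (Active M p Map.empty (\<phi> \<union> {CName p}))"

inductive performs :: "config \<Rightarrow> action list \<Rightarrow> config \<Rightarrow> bool" where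
  refl: "performs F [] F"
| tau: "aogs F Tau F' \<Longrightarrow> performs F' s G \<Longrightarrow> performs F s G"
| visible: "a \<noteq> Tau \<Longrightarrow> aogs F a F' \<Longrightarrow> performs F' s G \<Longrightarrow> performs F (a # s) G"

definition traces :: "config \<Rightarrow> action list set" where
  "traces F = {s. \<exists>G. performs F s G}"

primrec bound_names :: "action \<Rightarrow> name set" where
  "bound_names Tau = {}"
| "bound_names (PAns p x) = {VName x}"
| "bound_names (PQue x y q) = {VName y, CName q}"
| "bound_names (OAns q x) = {VName x}"
| "bound_names (OQue x y p) = {VName y, CName p}"
| "bound_names (IOQue p) = {CName p}"

primrec config_names :: "config \<Rightarrow> name set" where
  "config_names (Active M p \<gamma> \<phi>) = \<phi>"
| "config_names (Passive \<gamma> \<phi>) = \<phi>"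
| "config_names (Initial M \<phi>) = \<phi>"

text \<open>
  Traces are compared up to the choice of bound names, so only traces whose bound names are fresh
  for both configurations count. Without this proviso the name sets themselves would be
  observable: the \<open>\<phi>\<close> of one configuration may contain a name that the other one is still free
  to use as a bound name, e.g. when two terms have different free variables.
\<close>

definition trace_equiv :: "config \<Rightarrow> config \<Rightarrow> bool" (infix "\<simeq>\<^sub>A" 50) where
  "F \<simeq>\<^sub>A G \<longleftrightarrow>
     (\<forall>s. (\<Union>a\<in>set s. bound_names a) \<inter> (config_names F \<union> config_names G) = {} \<longrightarrow>
          (s \<in> traces F \<longleftrightarrow> s \<in> traces G))"

definition init_config :: "trm \<Rightarrow> config" where
  "init_config M = Initial M (VName ` fv M)"

end

theory Submission
  imports Defs
begin

text \<open>
  Reduction is deterministic and configurations have no shared state, so trace inclusion coincides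
  with eager normal form similarity: if \<open>M\<close> evaluates to a value \<open>V\<close>, then \<open>M'\<close> evaluates to a value
  \<open>V'\<close> with \<open>V y\<close> below \<open>V' y\<close> for fresh \<open>y\<close>; if \<open>M\<close> evaluates to \<open>E[x V]\<close>, then \<open>M'\<close> evaluates
  to some \<open>E'[x V']\<close> with \<open>V y\<close> below \<open>V' y\<close> and \<open>E[y]\<close> below \<open>E'[y]\<close>. Similarity is a congruence
  because the pairs \<open>K[M]\<sigma>\<close>, \<open>K'[M']\<sigma>'\<close> built from similar terms, stacks of similar contexts and
  chains of similar values form a simulation. When \<open>M\<close> reaches a normal form \<open>F[x U]\<close> with \<open>x\<close>
  bound to \<open>V\<close> in \<open>\<sigma>\<close>, push \<open>F\<close>, bind a fresh \<open>y\<close> to \<open>U\<close> and continue with \<open>V y\<close>; when it reaches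
  a value \<open>U\<close>, pop a context \<open>E\<close>, bind a fresh \<open>y\<close> to \<open>U\<close> and continue with \<open>E[y]\<close>. Neither move
  changes the represented term, and only finitely many of them can happen in a row.
\<close>

section \<open>Substitution and evaluation contexts\<close>

primrec msubst :: "(var \<Rightarrow> trm) \<Rightarrow> trm \<Rightarrow> trm" where
  "msubst \<sigma> (FVar x) = \<sigma> x"
| "msubst \<sigma> (BVar i) = BVar i"
| "msubst \<sigma> (App M N) = App (msubst \<sigma> M) (msubst \<sigma> N)"
| "msubst \<sigma> (Lam M) = Lam (msubst \<sigma> M)"

primrec ectx_comp :: "ectx \<Rightarrow> ectx \<Rightarrow> ectx" where
  "ectx_comp EHole F = F"
| "ectx_comp (EArg V E) F = EArg V (ectx_comp E F)"
| "ectx_comp (EFun E N) F = EFun (ectx_comp E F) N"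

primrec msubst_ectx :: "(var \<Rightarrow> trm) \<Rightarrow> ectx \<Rightarrow> ectx" where
  "msubst_ectx \<sigma> EHole = EHole"
| "msubst_ectx \<sigma> (EArg V E) = EArg (msubst \<sigma> V) (msubst_ectx \<sigma> E)"
| "msubst_ectx \<sigma> (EFun E N) = EFun (msubst_ectx \<sigma> E) (msubst \<sigma> N)"

primrec fv_ectx :: "ectx \<Rightarrow> var set" where
  "fv_ectx EHole = {}"
| "fv_ectx (EArg V E) = fv V \<union> fv_ectx E"
| "fv_ectx (EFun E N) = fv_ectx E \<union> fv N"

primrec lc_ectx :: "ectx \<Rightarrow> bool" where
  "lc_ectx EHole = True"
| "lc_ectx (EArg V E) = (lc V \<and> lc_ectx E)"
| "lc_ectx (EFun E N) = (lc_ectx E \<and> lc N)"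

text \<open>Substituting values keeps evaluation contexts and redexes in shape, so reduction is
  preserved. Local closure lets \<open>msubst\<close> pass under \<open>Lam\<close> without shifting
  and commute with \<open>open_at\<close>.\<close>

definition value_subst :: "(var \<Rightarrow> trm) \<Rightarrow> bool" where
  "value_subst \<sigma> \<longleftrightarrow> (\<forall>x. is_value (\<sigma> x) \<and> lc (\<sigma> x))"

lemma finite_fv [simp]: "finite (fv M)"
  by (induction M) auto

lemma finite_fv_ectx [simp]: "finite (fv_ectx E)"
  by (induction E) auto

lemma plug_ectx_comp [simp]: "plug (ectx_comp E F) M = plug E (plug F M)"
  by (induction E) auto

lemma is_ectx_comp [simp]: "is_ectx (ectx_comp E F) \<longleftrightarrow> is_ectx E \<and> is_ectx F"
  by (induction E) auto

lemma lc_plug [simp]: "lc (plug E M) \<longleftrightarrow> lc_ectx E \<and> lc M"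
  by (induction E) auto

lemma msubst_plug [simp]: "msubst \<sigma> (plug E M) = plug (msubst_ectx \<sigma> E) (msubst \<sigma> M)"
  by (induction E) auto

lemma is_value_msubst: "value_subst \<sigma> \<Longrightarrow> is_value V \<Longrightarrow> is_value (msubst \<sigma> V)"
  by (cases V) (auto simp: value_subst_def)

lemma is_ectx_msubst: "value_subst \<sigma> \<Longrightarrow> is_ectx E \<Longrightarrow> is_ectx (msubst_ectx \<sigma> E)"
  by (induction E) (auto simp: is_value_msubst)

section \<open>Local closure and opening under substitution\<close>

lemma lc_at_mono: "lc_at j M \<Longrightarrow> j \<le> k \<Longrightarrow> lc_at k M"
  by (induction M arbitrary: j k) fastforce+

lemma lc_at_open_at: "lc_at (Suc k) M \<Longrightarrow> lc V \<Longrightarrow> lc_at k (open_at k V M)"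
  by (induction M arbitrary: k) (auto intro: lc_at_mono)

lemma open_at_lc_at: "lc_at k M \<Longrightarrow> k \<le> j \<Longrightarrow> open_at j V M = M"
  by (induction M arbitrary: k j) fastforce+

lemma lc_at_close_at: "lc_at k M \<Longrightarrow> lc_at (Suc k) (close_at k x M)"
  by (induction M arbitrary: k) auto

lemma lc_lam: "lc M \<Longrightarrow> lc (lam x M)"
  by (simp add: lam_def lc_at_close_at)

lemma lc_at_msubst: "value_subst \<sigma> \<Longrightarrow> lc_at k M \<Longrightarrow> lc_at k (msubst \<sigma> M)"
  by (induction M arbitrary: k) (auto simp: value_subst_def intro: lc_at_mono)

lemma lc_ectx_msubst: "value_subst \<sigma> \<Longrightarrow> lc_ectx E \<Longrightarrow> lc_ectx (msubst_ectx \<sigma> E)"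
  by (induction E) (auto simp: lc_at_msubst)

lemma msubst_open_at:
  "value_subst \<sigma> \<Longrightarrow> msubst \<sigma> (open_at k V M) = open_at k (msubst \<sigma> V) (msubst \<sigma> M)"
  by (induction M arbitrary: k) (auto simp: value_subst_def open_at_lc_at[of 0])

lemma msubst_cong: "(\<And>x. x \<in> fv M \<Longrightarrow> \<sigma> x = \<tau> x) \<Longrightarrow> msubst \<sigma> M = msubst \<tau> M"
  by (induction M) auto

lemma msubst_upd_fresh [simp]: "y \<notin> fv M \<Longrightarrow> msubst (\<sigma>(y := V)) M = msubst \<sigma> M"
  by (rule msubst_cong) auto

lemma msubst_ectx_upd_fresh [simp]:
  "y \<notin> fv_ectx E \<Longrightarrow> msubst_ectx (\<sigma>(y := V)) E = msubst_ectx \<sigma> E"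
  by (induction E) auto

lemma msubst_FVar [simp]: "msubst FVar M = M"
  by (induction M) auto

lemma msubst_FVar_upd: "msubst (FVar(x := V)) M = subst M x V"
  by (induction M) auto

lemma msubst_ectx_FVar [simp]: "msubst_ectx FVar E = E"
  by (induction E) auto

lemma value_subst_FVar [simp]: "value_subst FVar"
  by (simp add: value_subst_def)

section \<open>Determinism\<close>

lemma plug_not_value: "is_value (plug E (App V W)) \<Longrightarrow> False"
  by (cases E) auto

text \<open>The plugged term is an application, so by \<open>plug_not_value\<close> neither hole can
  lie inside a part that the other context treats as a value. As \<open>V\<close> may be any value,
  redexes and stuck calls are covered together and are also kept apart.\<close>

lemma unique_decomposition:
  assumes "plug E (App V W) = plug E' (App V' W')" "is_ectx E" "is_ectx E'"
    "is_value V" "is_value W" "is_value V'" "is_value W'"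
  shows "E = E' \<and> V = V' \<and> W = W'"
  using assms
proof (induction E arbitrary: E')
  case EHole
  then show ?case by (cases E') (auto dest: plug_not_value)
next
  case (EArg X E)
  then show ?case by (cases E') (auto dest: plug_not_value)
next
  case (EFun E X)
  then show ?case by (cases E') (auto dest: plug_not_value)
qed

text \<open>Nested uses of rule \<open>ectx\<close> merge into one context by
  \<open>ectx_comp\<close>, which makes \<open>unique_decomposition\<close> applicable to
  steps.\<close>

lemma step_cases:
  assumes "M \<rightarrow>\<^sub>v N"
  obtains E P V where "is_ectx E" "is_value V" "M = plug E (App (Lam P) V)"
    "N = plug E (open_at 0 V P)"
proof -
  from assms have "\<exists>E P V. is_ectx E \<and> is_value V \<and> M = plug E (App (Lam P) V) \<and>
      N = plug E (open_at 0 V P)"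
  proof induction
    case (beta V M)
    then show ?case by (intro exI[of _ EHole] exI[of _ M] exI[of _ V]) simp
  next
    case (ectx M N F)
    then obtain E P V where "is_ectx E" "is_value V" "M = plug E (App (Lam P) V)"
      "N = plug E (open_at 0 V P)" by blast
    with ectx show ?case
      by (intro exI[of _ "ectx_comp F E"] exI[of _ P] exI[of _ V]) simp
  qed
  with that show ?thesis by blast
qed

lemma step_deterministic: "M \<rightarrow>\<^sub>v N \<Longrightarrow> M \<rightarrow>\<^sub>v N' \<Longrightarrow> N = N'"
  by (elim step_cases) (auto dest!: unique_decomposition)

lemma value_no_step: "is_value M \<Longrightarrow> \<not> M \<rightarrow>\<^sub>v N"
  by (auto elim!: step_cases dest: plug_not_value)

lemma stuck_no_step:
  "is_ectx E \<Longrightarrow> is_value V \<Longrightarrow> \<not> plug E (App (FVar x) V) \<rightarrow>\<^sub>v N"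
  by (auto elim!: step_cases dest!: unique_decomposition)

lemma lc_step: "M \<rightarrow>\<^sub>v N \<Longrightarrow> lc M \<Longrightarrow> lc N"
  by (auto elim!: step_cases simp: lc_at_open_at)

lemma lc_steps: "step\<^sup>*\<^sup>* M N \<Longrightarrow> lc M \<Longrightarrow> lc N"
  by (induction rule: rtranclp_induct) (auto intro: lc_step)

lemma step_msubst: "M \<rightarrow>\<^sub>v N \<Longrightarrow> value_subst \<sigma> \<Longrightarrow> msubst \<sigma> M \<rightarrow>\<^sub>v msubst \<sigma> N"
  by (auto elim!: step_cases simp: msubst_open_at is_value_msubst is_ectx_msubst
      intro!: step.intros)

lemma steps_msubst: "step\<^sup>*\<^sup>* M N \<Longrightarrow> value_subst \<sigma> \<Longrightarrow> step\<^sup>*\<^sup>* (msubst \<sigma> M) (msubst \<sigma> N)"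
  by (induction rule: rtranclp_induct) (auto intro: step_msubst rtranclp.rtrancl_into_rtrancl)

lemma steps_plug: "step\<^sup>*\<^sup>* M N \<Longrightarrow> is_ectx E \<Longrightarrow> step\<^sup>*\<^sup>* (plug E M) (plug E N)"
  by (induction rule: rtranclp_induct) (auto intro: step.ectx rtranclp.rtrancl_into_rtrancl)

lemma steps_normal_unique:
  assumes "step\<^sup>*\<^sup>* M N" "step\<^sup>*\<^sup>* M N'" "\<And>X. \<not> N \<rightarrow>\<^sub>v X" "\<And>X. \<not> N' \<rightarrow>\<^sub>v X"
  shows "N = N'"
  using assms
proof (induction rule: converse_rtranclp_induct)
  case base
  then show ?case by (metis converse_rtranclpE)
next
  case (step M M1)
  then show ?case by (metis converse_rtranclpE step_deterministic)
qed

section \<open>Progress: values, steps and stuck calls\<close>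

lemma progress:
  assumes "lc M"
  shows "is_value M \<or> (\<exists>E V W. is_ectx E \<and> is_value V \<and> is_value W \<and> M = plug E (App V W))"
  using assms
proof (induction M)
  case (App M N)
  consider "\<not> is_value M" | "is_value M" "\<not> is_value N" | "is_value M" "is_value N" by blast
  then show ?case
  proof cases
    case 1
    with App obtain E V W where "is_ectx E \<and> is_value V \<and> is_value W \<and> M = plug E (App V W)"
      by auto
    then show ?thesis
      by (intro disjI2 exI[of _ "EFun E N"] exI[of _ V] exI[of _ W]) simp
  next
    case 2
    with App obtain E V W where "is_ectx E \<and> is_value V \<and> is_value W \<and> N = plug E (App V W)"
      by auto
    with 2 show ?thesis
      by (intro disjI2 exI[of _ "EArg M E"] exI[of _ V] exI[of _ W]) simp
  next
    case 3
    then show ?thesis by (intro disjI2 exI[of _ EHole] exI[of _ M] exI[of _ N]) simp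
  qed
qed auto

lemma term_cases:
  assumes "lc M"
  obtains (val) "is_value M"
  | (step) N where "M \<rightarrow>\<^sub>v N"
  | (stuck) E x V where "is_ectx E" "is_value V" "M = plug E (App (FVar x) V)"
proof -
  from progress[OF assms]
  consider "is_value M"
    | E V W where "is_ectx E" "is_value V" "is_value W" "M = plug E (App V W)" by blast
  then show thesis
  proof cases
    case (2 E V W)
    show thesis
    proof (cases V)
      case (Lam P)
      with 2 have "M \<rightarrow>\<^sub>v plug E (open_at 0 W P)" by (simp add: step.intros)
      then show thesis by (rule that)
    qed (use 2 that in auto)
  qed (rule that)
qed

section \<open>Eager normal form similarity\<close>

text \<open>Freshness is expressed by cofinite quantification: a proof may exclude finitely many
  names, and a use may pick \<open>y\<close> away from any finite set. For \<open>sim\<close> the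
  exclusion is later removed by renaming.\<close>

definition val_rel :: "(trm \<Rightarrow> trm \<Rightarrow> bool) \<Rightarrow> trm \<Rightarrow> trm \<Rightarrow> bool" where
  "val_rel R V V' \<longleftrightarrow> is_value V \<and> is_value V' \<and>
     (\<exists>L. finite L \<and> (\<forall>y. y \<notin> L \<longrightarrow> R (App V (FVar y)) (App V' (FVar y))))"

definition ectx_rel :: "(trm \<Rightarrow> trm \<Rightarrow> bool) \<Rightarrow> ectx \<Rightarrow> ectx \<Rightarrow> bool" where
  "ectx_rel R E E' \<longleftrightarrow> is_ectx E \<and> is_ectx E' \<and>
     (\<exists>L. finite L \<and> (\<forall>y. y \<notin> L \<longrightarrow> R (plug E (FVar y)) (plug E' (FVar y))))"

text \<open>A term that can step satisfies this vacuously (\<open>nf_match_step\<close>).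
  \<open>R\<close> occurs only positively, which gives the monotonicity that the coinductive
  definition of \<open>sim\<close> relies on.\<close>

definition nf_match :: "(trm \<Rightarrow> trm \<Rightarrow> bool) \<Rightarrow> trm \<Rightarrow> trm \<Rightarrow> bool" where
  "nf_match R M M' \<longleftrightarrow>
     (is_value M \<longrightarrow> (\<exists>V'. step\<^sup>*\<^sup>* M' V' \<and> val_rel R M V')) \<and>
     (\<forall>E x V. is_ectx E \<longrightarrow> is_value V \<longrightarrow> M = plug E (App (FVar x) V) \<longrightarrow>
        (\<exists>E' V'. step\<^sup>*\<^sup>* M' (plug E' (App (FVar x) V')) \<and> ectx_rel R E E' \<and> val_rel R V V'))"

lemma val_rel_mono: "(\<And>x y. R x y \<longrightarrow> R' x y) \<Longrightarrow> val_rel R V V' \<longrightarrow> val_rel R' V V'"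
  unfolding val_rel_def by blast

lemma ectx_rel_mono: "(\<And>x y. R x y \<longrightarrow> R' x y) \<Longrightarrow> ectx_rel R E E' \<longrightarrow> ectx_rel R' E E'"
  unfolding ectx_rel_def by blast

lemma nf_match_mono [mono]:
  "(\<And>x y. R x y \<longrightarrow> R' x y) \<Longrightarrow> nf_match R M M' \<longrightarrow> nf_match R' M M'"
proof -
  assume "\<And>x y. R x y \<longrightarrow> R' x y"
  then have "\<And>V V'. val_rel R V V' \<Longrightarrow> val_rel R' V V'"
    and "\<And>E E'. ectx_rel R E E' \<Longrightarrow> ectx_rel R' E E'"
    using val_rel_mono[of R R'] ectx_rel_mono[of R R'] by blast+
  then show ?thesis
    unfolding nf_match_def by blast
qed

text \<open>A step on the left leaves the right term in place; the right term has to reduce only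
  once the left one is a normal form. Hence a diverging locally closed term is below every locally
  closed term.\<close>

coinductive sim :: "trm \<Rightarrow> trm \<Rightarrow> bool" where
  "lc M \<Longrightarrow> lc M' \<Longrightarrow> (\<forall>N. M \<rightarrow>\<^sub>v N \<longrightarrow> sim N M') \<Longrightarrow> nf_match sim M M' \<Longrightarrow> sim M M'"

lemma sim_lc: "sim M M' \<Longrightarrow> lc M \<and> lc M'"
  by (auto elim: sim.cases)

lemma sim_step: "sim M M' \<Longrightarrow> M \<rightarrow>\<^sub>v N \<Longrightarrow> sim N M'"
  by (auto elim: sim.cases)

lemma sim_nf_match: "sim M M' \<Longrightarrow> nf_match sim M M'"
  by (auto elim: sim.cases)

lemma sim_simulation:
  assumes "\<And>M M'. R M M' \<Longrightarrow>
      lc M \<and> lc M' \<and> (\<forall>N. M \<rightarrow>\<^sub>v N \<longrightarrow> R N M') \<and> nf_match R M M'"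
    and "R M M'"
  shows "sim M M'"
  using assms(2)
proof (rule sim.coinduct[of R])
  fix M M' assume R: "R M M'"
  have "nf_match R M M' \<longrightarrow> nf_match (\<lambda>x y. R x y \<or> sim x y) M M'"
    by (rule nf_match_mono) blast
  with assms(1)[OF R] show "\<exists>N N'. M = N \<and> M' = N' \<and> lc N \<and> lc N' \<and>
      (\<forall>P. N \<rightarrow>\<^sub>v P \<longrightarrow> R P N' \<or> sim P N') \<and> nf_match (\<lambda>x y. R x y \<or> sim x y) N N'"
    by blast
qed

lemma sim_value:
  assumes "sim M M'" "is_value M"
  obtains V' where "step\<^sup>*\<^sup>* M' V'" "val_rel sim M V'"
  using sim_nf_match[OF assms(1)] assms(2) unfolding nf_match_def by blast

lemma sim_stuck:
  assumes "sim (plug E (App (FVar x) V)) M'" "is_ectx E" "is_value V"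
  obtains E' V' where "step\<^sup>*\<^sup>* M' (plug E' (App (FVar x) V'))"
    "ectx_rel sim E E'" "val_rel sim V V'"
  using sim_nf_match[OF assms(1)] assms(2,3) unfolding nf_match_def by blast

lemma nf_match_refl:
  assumes "\<And>N. lc N \<Longrightarrow> R N N" "lc M"
  shows "nf_match R M M"
  using assms unfolding nf_match_def val_rel_def ectx_rel_def
  by (fastforce intro!: exI[of _ "{}"])

lemma nf_match_expand: "step\<^sup>*\<^sup>* M' N' \<Longrightarrow> nf_match R M N' \<Longrightarrow> nf_match R M M'"
  unfolding nf_match_def using rtranclp_trans[of step M' N'] by blast

text \<open>The right term is only asked what it reduces to, so extra steps in front of it are
  harmless. The candidate relation is \<open>sim\<close> preceded on the right by reduction.\<close>

lemma sim_expand: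
  assumes "step\<^sup>*\<^sup>* M' N'" "sim M N'" "lc M'"
  shows "sim M M'"
proof (rule sim_simulation[where R = "\<lambda>M M'. lc M' \<and> (\<exists>N'. step\<^sup>*\<^sup>* M' N' \<and> sim M N')"])
  fix M M'
  let ?R = "\<lambda>M M'. lc M' \<and> (\<exists>N'. step\<^sup>*\<^sup>* M' N' \<and> sim M N')"
  assume "?R M M'"
  then obtain N' where N': "step\<^sup>*\<^sup>* M' N'" "sim M N'" "lc M'" by blast
  have "nf_match sim M N' \<longrightarrow> nf_match ?R M N'"
    by (rule nf_match_mono) (use sim_lc in blast)
  then have "nf_match ?R M M'" using nf_match_expand N' sim_nf_match by blast
  with N' show "lc M \<and> lc M' \<and> (\<forall>N. M \<rightarrow>\<^sub>v N \<longrightarrow> ?R N M') \<and> nf_match ?R M M'"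
    using sim_lc sim_step by blast
qed (use assms in blast)

lemma nf_match_value: "step\<^sup>*\<^sup>* M' V' \<Longrightarrow> val_rel R V V' \<Longrightarrow> nf_match R V M'"
  unfolding nf_match_def using plug_not_value by (metis val_rel_def)

lemma nf_match_step: "M \<rightarrow>\<^sub>v N \<Longrightarrow> nf_match R M M'"
  unfolding nf_match_def using value_no_step stuck_no_step by blast

lemma sim_left_expand: "M \<rightarrow>\<^sub>v N \<Longrightarrow> sim N M' \<Longrightarrow> lc M \<Longrightarrow> sim M M'"
  by (rule sim.intros) (auto dest: sim_lc step_deterministic intro: nf_match_step)

text \<open>The identity is not a suitable candidate, since left steps leave the right term behind;
  the candidate relates each reduct to the term it came from.\<close>

lemma sim_refl:
  assumes "lc M"
  shows "sim M M"
proof (rule sim_simulation[where R = "\<lambda>M M'. lc M' \<and> step\<^sup>*\<^sup>* M' M"])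
  fix M M'
  let ?R = "\<lambda>M M'. lc M' \<and> step\<^sup>*\<^sup>* M' M"
  assume R: "?R M M'"
  then have "nf_match ?R M M" by (intro nf_match_refl) (auto intro: lc_steps)
  with R have "nf_match ?R M M'" using nf_match_expand by blast
  with R show "lc M \<and> lc M' \<and> (\<forall>N. M \<rightarrow>\<^sub>v N \<longrightarrow> ?R N M') \<and> nf_match ?R M M'"
    using lc_steps by (auto intro: rtranclp.rtrancl_into_rtrancl)
qed (use assms in blast)

section \<open>Congruence\<close>

lemma ex_fresh: "finite L \<Longrightarrow> \<exists>y::nat. y \<notin> L"
  using ex_new_if_finite infinite_UNIV_nat by blast

lemma val_rel_value: "val_rel R V V' \<Longrightarrow> is_value V \<and> is_value V'"
  by (simp add: val_rel_def)

lemma ectx_rel_ectx: "ectx_rel R E E' \<Longrightarrow> is_ectx E \<and> is_ectx E'"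
  by (simp add: ectx_rel_def)

lemma val_rel_fresh:
  assumes "val_rel R V V'" "finite L"
  obtains y where "y \<notin> L" "R (App V (FVar y)) (App V' (FVar y))"
proof -
  from assms(1) obtain L' where L': "finite L'"
    "\<And>y. y \<notin> L' \<Longrightarrow> R (App V (FVar y)) (App V' (FVar y))"
    unfolding val_rel_def by blast
  with assms(2) obtain y where "y \<notin> L \<union> L'" using ex_fresh[of "L \<union> L'"] by auto
  with L' that show thesis by blast
qed

lemma ectx_rel_fresh:
  assumes "ectx_rel R E E'" "finite L"
  obtains y where "y \<notin> L" "R (plug E (FVar y)) (plug E' (FVar y))"
proof -
  from assms(1) obtain L' where L': "finite L'"
    "\<And>y. y \<notin> L' \<Longrightarrow> R (plug E (FVar y)) (plug E' (FVar y))"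
    unfolding ectx_rel_def by blast
  with assms(2) obtain y where "y \<notin> L \<union> L'" using ex_fresh[of "L \<union> L'"] by auto
  with L' that show thesis by blast
qed

lemma val_rel_lc: "val_rel sim V V' \<Longrightarrow> lc V \<and> lc V'"
  using sim_lc by (elim val_rel_fresh[of _ _ _ "{}"]) fastforce+

lemma ectx_rel_lc: "ectx_rel sim E E' \<Longrightarrow> lc_ectx E \<and> lc_ectx E'"
  using sim_lc by (elim ectx_rel_fresh[of _ _ _ "{}"]) fastforce+

text \<open>Layers are related one at a time, the last one pushed being innermost. Relating the
  composed context by \<open>ectx_rel\<close> would presuppose that plugging preserves
  \<open>sim\<close>, which is what is being proved.\<close>

inductive stack_sim :: "ectx \<Rightarrow> ectx \<Rightarrow> bool" where
  empty: "stack_sim EHole EHole"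
| push: "ectx_rel sim E E' \<Longrightarrow> stack_sim K K' \<Longrightarrow> stack_sim (ectx_comp K E) (ectx_comp K' E')"

lemma lc_ectx_comp [simp]: "lc_ectx (ectx_comp E F) \<longleftrightarrow> lc_ectx E \<and> lc_ectx F"
  by (induction E) auto

lemma stack_sim_wf:
  "stack_sim K K' \<Longrightarrow> is_ectx K \<and> is_ectx K' \<and> lc_ectx K \<and> lc_ectx K'"
  by (induction rule: stack_sim.induct) (auto dest: ectx_rel_ectx ectx_rel_lc)

text \<open>
  \<open>\<sigma>\<close> and \<open>\<sigma>'\<close> unfold chains of bindings \<open>x \<mapsto> V\<close> and \<open>x \<mapsto> V'\<close> with similar \<open>V\<close>, \<open>V'\<close>, where
  \<open>V\<close> may mention variables that are bound earlier. The rank \<open>r\<close> bounds the number of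
  variable-to-variable bindings that have to be followed on the left to reach an abstraction or
  a variable outside of the domain \<open>A\<close>.
\<close>

definition env_sim ::
  "var set \<Rightarrow> var set \<Rightarrow> (var \<Rightarrow> nat) \<Rightarrow> (var \<Rightarrow> trm) \<Rightarrow> (var \<Rightarrow> trm) \<Rightarrow> bool" where
  "env_sim A B r \<sigma> \<sigma>' \<longleftrightarrow> finite B \<and> A \<subseteq> B \<and> value_subst \<sigma> \<and> value_subst \<sigma>' \<and>
     (\<forall>x. x \<notin> A \<longrightarrow> \<sigma> x = FVar x \<and> \<sigma>' x = FVar x) \<and>
     (\<forall>x\<in>A. \<exists>V V'. val_rel sim V V' \<and> fv V \<union> fv V' \<subseteq> B \<and>
        \<sigma> x = msubst \<sigma> V \<and> \<sigma>' x = msubst \<sigma>' V' \<and> (\<forall>z. V = FVar z \<longrightarrow> r z < r x))"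

lemma env_sim_value_subst: "env_sim A B r \<sigma> \<sigma>' \<Longrightarrow> value_subst \<sigma> \<and> value_subst \<sigma>'"
  by (simp add: env_sim_def)

lemma env_sim_empty: "env_sim {} {} r FVar FVar"
  by (simp add: env_sim_def)

text \<open>\<open>B\<close> collects the variables of the domain and of the bound values, so a
  \<open>y\<close> outside \<open>B\<close> leaves all older equations intact. If \<open>U\<close>
  is a variable \<open>z\<close>, the chain from \<open>y\<close> is one link longer than that from
  \<open>z\<close>; an abstraction ends the chain and gets rank 0.\<close>

lemma env_sim_extend:
  assumes env: "env_sim A B r \<sigma> \<sigma>'" and val: "val_rel sim U U'"
    and fresh: "y \<notin> B" "y \<notin> fv U" "y \<notin> fv U'"
  shows "env_sim (insert y A) (insert y (B \<union> fv U \<union> fv U'))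
    (r(y := (case U of FVar z \<Rightarrow> Suc (r z) | _ \<Rightarrow> 0)))
    (\<sigma>(y := msubst \<sigma> U)) (\<sigma>'(y := msubst \<sigma>' U'))"
proof -
  let ?r = "r(y := (case U of FVar z \<Rightarrow> Suc (r z) | _ \<Rightarrow> 0))"
  let ?\<sigma> = "\<sigma>(y := msubst \<sigma> U)" and ?\<sigma>' = "\<sigma>'(y := msubst \<sigma>' U')"
  note env' = env[unfolded env_sim_def]
  have vs: "value_subst \<sigma>" "value_subst \<sigma>'" using env' by auto
  have "value_subst ?\<sigma>" "value_subst ?\<sigma>'"
    using vs val_rel_value[OF val] val_rel_lc[OF val]
      is_value_msubst[OF vs(1)] is_value_msubst[OF vs(2)] lc_at_msubst[OF vs(1)] lc_at_msubst[OF vs(2)]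
    unfolding value_subst_def by auto
  moreover have "\<exists>V V'. val_rel sim V V' \<and> fv V \<union> fv V' \<subseteq> insert y (B \<union> fv U \<union> fv U') \<and>
      ?\<sigma> x = msubst ?\<sigma> V \<and> ?\<sigma>' x = msubst ?\<sigma>' V' \<and> (\<forall>z. V = FVar z \<longrightarrow> ?r z < ?r x)"
    if "x \<in> insert y A" for x
  proof (cases "x = y")
    case True
    with val fresh show ?thesis
      by (intro exI[of _ U] exI[of _ U']) auto
  next
    case False
    with that env' obtain V V' where V: "val_rel sim V V'" "fv V \<union> fv V' \<subseteq> B"
      "\<sigma> x = msubst \<sigma> V" "\<sigma>' x = msubst \<sigma>' V'" "\<forall>z. V = FVar z \<longrightarrow> r z < r x"
      by (metis insertE)
    then have "y \<notin> fv V" "y \<notin> fv V'" using fresh by auto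
    with V False show ?thesis
      by (intro exI[of _ V] exI[of _ V']) auto
  qed
  ultimately show ?thesis
    using env' unfolding env_sim_def by auto
qed

text \<open>On the right it suffices to reach the represented term by reduction: a push or pop first
  evaluates the right component to a matching normal form, while the simulation keeps the original
  right term.\<close>

definition clos :: "trm \<Rightarrow> trm \<Rightarrow> bool" where
  "clos T T' \<longleftrightarrow> lc T' \<and> (\<exists>M M' K K' A B r \<sigma> \<sigma>'. sim M M' \<and> stack_sim K K' \<and>
     env_sim A B r \<sigma> \<sigma>' \<and> T = msubst \<sigma> (plug K M) \<and> step\<^sup>*\<^sup>* T' (msubst \<sigma>' (plug K' M')))"

lemma lc_state:
  assumes "sim M M'" "stack_sim K K'" "env_sim A B r \<sigma> \<sigma>'"
  shows "lc (msubst \<sigma> (plug K M))" "lc (msubst \<sigma>' (plug K' M'))"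
  using sim_lc[OF assms(1)] stack_sim_wf[OF assms(2)] env_sim_value_subst[OF assms(3)]
  by (auto intro: lc_at_msubst lc_ectx_msubst)

lemma closI:
  assumes "sim M M'" "stack_sim K K'" "env_sim A B r \<sigma> \<sigma>'"
  shows "clos (msubst \<sigma> (plug K M)) (msubst \<sigma>' (plug K' M'))"
  unfolding clos_def using assms lc_state[OF assms] by blast

lemma clos_expand: "step\<^sup>*\<^sup>* T' T'' \<Longrightarrow> clos T T'' \<Longrightarrow> lc T' \<Longrightarrow> clos T T'"
  unfolding clos_def by (elim conjE exE) (intro conjI exI, auto)

text \<open>This is the simulation clause for \<open>clos\<close> apart from local closure. Pushes
  and pops leave \<open>T\<close> unchanged and only reduce \<open>T'\<close>, so the clause can be
  carried back along them by \<open>clos_progress_expand\<close>.\<close>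

definition clos_progress :: "trm \<Rightarrow> trm \<Rightarrow> bool" where
  "clos_progress T T' \<longleftrightarrow> (\<forall>T1. T \<rightarrow>\<^sub>v T1 \<longrightarrow> clos T1 T') \<and> nf_match clos T T'"

lemma clos_progress_expand:
  "step\<^sup>*\<^sup>* T' T'' \<Longrightarrow> clos_progress T T'' \<Longrightarrow> lc T' \<Longrightarrow> clos_progress T T'"
  unfolding clos_progress_def using clos_expand nf_match_expand by blast

lemma steps_state:
  assumes "step\<^sup>*\<^sup>* M N" "is_ectx K" "value_subst \<sigma>"
  shows "step\<^sup>*\<^sup>* (msubst \<sigma> (plug K M)) (msubst \<sigma> (plug K N))"
  using steps_msubst[OF steps_plug[OF assms(1,2)] assms(3)] .

section \<open>Progress of represented states\<close>

lemma clos_progress_step: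
  assumes "sim M M'" "stack_sim K K'" "env_sim A B r \<sigma> \<sigma>'" "M \<rightarrow>\<^sub>v N"
  shows "clos_progress (msubst \<sigma> (plug K M)) (msubst \<sigma>' (plug K' M'))"
proof -
  have "msubst \<sigma> (plug K M) \<rightarrow>\<^sub>v msubst \<sigma> (plug K N)"
    using assms stack_sim_wf env_sim_value_subst by (blast intro: step_msubst step.ectx)
  moreover have "clos (msubst \<sigma> (plug K N)) (msubst \<sigma>' (plug K' M'))"
    using assms sim_step closI by blast
  ultimately show ?thesis
    unfolding clos_progress_def using step_deterministic nf_match_step by metis
qed

lemma val_rel_clos:
  assumes "val_rel sim U U'" "env_sim A B r \<sigma> \<sigma>'"
  shows "val_rel clos (msubst \<sigma> U) (msubst \<sigma>' U')"
proof -
  from assms(1) obtain L where L: "finite L"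
    "\<And>y. y \<notin> L \<Longrightarrow> sim (App U (FVar y)) (App U' (FVar y))"
    unfolding val_rel_def by blast
  have "finite A" "\<And>y. y \<notin> A \<Longrightarrow> \<sigma> y = FVar y \<and> \<sigma>' y = FVar y"
    using assms(2) finite_subset unfolding env_sim_def by auto
  moreover have "clos (msubst \<sigma> (App U (FVar y))) (msubst \<sigma>' (App U' (FVar y)))" if "y \<notin> L" for y
    using closI[OF L(2)[OF that] stack_sim.empty assms(2)] by simp
  ultimately have "clos (App (msubst \<sigma> U) (FVar y)) (App (msubst \<sigma>' U') (FVar y))"
    if "y \<notin> L \<union> A" for y
    using that by (metis UnCI msubst.simps(1,3))
  with \<open>finite A\<close> show ?thesis
    using L(1) val_rel_value[OF assms(1)] env_sim_value_subst[OF assms(2)]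
    unfolding val_rel_def
    by (intro conjI exI[of _ "L \<union> A"]) (auto simp: is_value_msubst)
qed

lemma ectx_rel_clos:
  assumes "ectx_rel sim F F'" "stack_sim K K'" "env_sim A B r \<sigma> \<sigma>'"
  shows "ectx_rel clos (msubst_ectx \<sigma> (ectx_comp K F)) (msubst_ectx \<sigma>' (ectx_comp K' F'))"
proof -
  from assms(1) obtain L where L: "finite L"
    "\<And>y. y \<notin> L \<Longrightarrow> sim (plug F (FVar y)) (plug F' (FVar y))"
    unfolding ectx_rel_def by blast
  have "finite A" "\<And>y. y \<notin> A \<Longrightarrow> \<sigma> y = FVar y \<and> \<sigma>' y = FVar y"
    using assms(3) finite_subset unfolding env_sim_def by auto
  moreover have "clos (msubst \<sigma> (plug (ectx_comp K F) (FVar y)))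
      (msubst \<sigma>' (plug (ectx_comp K' F') (FVar y)))" if "y \<notin> L" for y
    using closI[OF L(2)[OF that] assms(2,3)] by simp
  ultimately have "clos (plug (msubst_ectx \<sigma> (ectx_comp K F)) (FVar y))
      (plug (msubst_ectx \<sigma>' (ectx_comp K' F')) (FVar y))" if "y \<notin> L \<union> A" for y
    using that by (metis UnCI msubst.simps(1) msubst_plug)
  with \<open>finite A\<close> show ?thesis
    using L(1) ectx_rel_ectx[OF assms(1)] stack_sim_wf[OF assms(2)] env_sim_value_subst[OF assms(3)]
    unfolding ectx_rel_def
    by (intro conjI exI[of _ "L \<union> A"]) (auto simp: is_ectx_msubst)
qed

text \<open>By induction on the rank of the head variable. A head outside \<open>A\<close> remains a
  genuine stuck call. A head bound to an abstraction leads to a beta step, and a head bound to a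
  variable leads to a stuck call whose head has smaller rank.\<close>

lemma clos_progress_stuck:
  assumes "sim (plug F (App (FVar x) U)) M'" "stack_sim K K'" "env_sim A B r \<sigma> \<sigma>'"
    "is_ectx F" "is_value U"
  shows "clos_progress (msubst \<sigma> (plug K (plug F (App (FVar x) U)))) (msubst \<sigma>' (plug K' M'))"
  using assms
proof (induction "r x" arbitrary: F x U M' K K' A B r \<sigma> \<sigma>' rule: less_induct)
  case less
  obtain F' U' where M': "step\<^sup>*\<^sup>* M' (plug F' (App (FVar x) U'))"
    and F: "ectx_rel sim F F'" and U: "val_rel sim U U'"
    using sim_stuck less.prems(1,4,5) by metis
  note vs = env_sim_value_subst[OF less.prems(3)]
  note K = stack_sim_wf[OF less.prems(2)]
  let ?T' = "msubst \<sigma>' (plug K' (plug F' (App (FVar x) U')))"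
  have steps: "step\<^sup>*\<^sup>* (msubst \<sigma>' (plug K' M')) ?T'"
    using steps_state[OF M'] K vs by blast
  have "clos_progress (msubst \<sigma> (plug K (plug F (App (FVar x) U)))) ?T'"
  proof (cases "x \<in> A")
    case False
    with less.prems(3) have x: "\<sigma> x = FVar x" "\<sigma>' x = FVar x" unfolding env_sim_def by auto
    let ?E = "msubst_ectx \<sigma> (ectx_comp K F)" and ?V = "msubst \<sigma> U"
    let ?E' = "msubst_ectx \<sigma>' (ectx_comp K' F')" and ?V' = "msubst \<sigma>' U'"
    have T: "msubst \<sigma> (plug K (plug F (App (FVar x) U))) = plug ?E (App (FVar x) ?V)"
      using msubst_plug[of \<sigma> "ectx_comp K F" "App (FVar x) U"] x by simp
    have T': "?T' = plug ?E' (App (FVar x) ?V')"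
      using msubst_plug[of \<sigma>' "ectx_comp K' F'" "App (FVar x) U'"] x by simp
    have E: "ectx_rel clos ?E ?E'" and V: "val_rel clos ?V ?V'"
      using ectx_rel_clos[OF F less.prems(2,3)] val_rel_clos[OF U less.prems(3)] .
    have wf: "is_ectx ?E" "is_value ?V" using ectx_rel_ectx[OF E] val_rel_value[OF V] by auto
    have "nf_match clos (plug ?E (App (FVar x) ?V)) (plug ?E' (App (FVar x) ?V'))"
      unfolding nf_match_def
    proof (intro conjI allI impI)
      fix E1 x1 V1
      assume "is_ectx E1" "is_value V1"
        "plug ?E (App (FVar x) ?V) = plug E1 (App (FVar x1) V1)"
      with wf have "E1 = ?E" "x1 = x" "V1 = ?V"
        using unique_decomposition[of ?E "FVar x" ?V E1 "FVar x1" V1] by auto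
      with E V show "\<exists>E2 V2. step\<^sup>*\<^sup>* (plug ?E' (App (FVar x) ?V')) (plug E2 (App (FVar x1) V2)) \<and>
          ectx_rel clos E1 E2 \<and> val_rel clos V1 V2" by blast
    qed (use plug_not_value in blast)
    with wf show ?thesis unfolding T T' clos_progress_def using stuck_no_step by blast
  next
    case True
    with less.prems(3) obtain V V' where V: "val_rel sim V V'" "\<sigma> x = msubst \<sigma> V"
      "\<sigma>' x = msubst \<sigma>' V'" "\<forall>z. V = FVar z \<longrightarrow> r z < r x"
      unfolding env_sim_def by metis
    have "finite B" using less.prems(3) unfolding env_sim_def by blast
    then obtain y where y: "sim (App V (FVar y)) (App V' (FVar y))"
      and fresh: "y \<notin> B \<union> fv U \<union> fv U' \<union> fv V \<union> fv V' \<union> fv_ectx F \<union> fv_ectx F' \<union>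
        fv_ectx K \<union> fv_ectx K'"
      using val_rel_fresh[OF V(1), of "B \<union> fv U \<union> fv U' \<union> fv V \<union> fv V' \<union> fv_ectx F \<union>
        fv_ectx F' \<union> fv_ectx K \<union> fv_ectx K'"] by auto
    let ?r = "r(y := (case U of FVar z \<Rightarrow> Suc (r z) | _ \<Rightarrow> 0))"
    let ?\<sigma> = "\<sigma>(y := msubst \<sigma> U)" and ?\<sigma>' = "\<sigma>'(y := msubst \<sigma>' U')"
    have env: "env_sim (insert y A) (insert y (B \<union> fv U \<union> fv U')) ?r ?\<sigma> ?\<sigma>'"
      using env_sim_extend[OF less.prems(3) U] fresh by auto
    have stack: "stack_sim (ectx_comp K F) (ectx_comp K' F')"
      using stack_sim.push[OF F less.prems(2)] .
    \<comment> \<open>Here \<open>y\<close> stands for \<open>U\<close> and \<open>x\<close> has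
      been unfolded to \<open>V\<close>; freshness of \<open>y\<close> keeps the update invisible
      everywhere else.\<close>
    have T: "msubst \<sigma> (plug K (plug F (App (FVar x) U))) =
        msubst ?\<sigma> (plug (ectx_comp K F) (App V (FVar y)))"
      and T': "?T' = msubst ?\<sigma>' (plug (ectx_comp K' F') (App V' (FVar y)))"
      using fresh V by simp_all
    show ?thesis
    proof (cases V)
      case (FVar z)
      \<comment> \<open>\<open>y\<close> differs from \<open>z\<close>, so the rank of
        \<open>z\<close> is unaffected by the update. The induction compares the new rank function
        at \<open>z\<close> with the old one at \<open>x\<close>.\<close>
      with fresh V(4) have "?r z < r x" by simp
      moreover have "sim (plug EHole (App (FVar z) (FVar y))) (App V' (FVar y))"
        using y FVar by simp
      ultimately have "clos_progress
          (msubst ?\<sigma> (plug (ectx_comp K F) (plug EHole (App (FVar z) (FVar y)))))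
          (msubst ?\<sigma>' (plug (ectx_comp K' F') (App V' (FVar y))))"
        by (rule less.hyps[OF _ _ stack env]) simp_all
      then show ?thesis
        unfolding T T' FVar plug.simps(1) .
    next
      case (Lam P)
      then have "App V (FVar y) \<rightarrow>\<^sub>v open_at 0 (FVar y) P" by (auto intro: step.beta)
      from clos_progress_step[OF y stack env this] show ?thesis unfolding T T' .
    qed (use val_rel_value[OF V(1)] in auto)
  qed
  then show ?case
    using clos_progress_expand[OF steps] lc_state(2)[OF less.prems(1-3)] by blast
qed

lemma clos_progress_nonvalue:
  assumes "sim M M'" "stack_sim K K'" "env_sim A B r \<sigma> \<sigma>'" "\<not> is_value M"
  shows "clos_progress (msubst \<sigma> (plug K M)) (msubst \<sigma>' (plug K' M'))"
proof -
  have "lc M" using sim_lc[OF assms(1)] ..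
  then show ?thesis
  proof (cases M rule: term_cases)
    case (step N)
    then show ?thesis using clos_progress_step assms by blast
  next
    case (stuck E x V)
    then show ?thesis using clos_progress_stuck assms by blast
  qed (use assms in blast)
qed

text \<open>By induction on the stack: a value pops one layer \<open>E\<close> and continues with
  \<open>plug E (FVar y)\<close>. This is again a value only if \<open>E\<close> is the hole, and
  then the shorter stack takes over; otherwise the non-value case applies.\<close>

lemma clos_progress_value:
  assumes "stack_sim K K'" "sim M M'" "env_sim A B r \<sigma> \<sigma>'" "is_value M"
  shows "clos_progress (msubst \<sigma> (plug K M)) (msubst \<sigma>' (plug K' M'))"
  using assms
proof (induction arbitrary: M M' A B r \<sigma> \<sigma>' rule: stack_sim.induct)
  case empty
  obtain U' where U': "step\<^sup>*\<^sup>* M' U'" "val_rel sim M U'" using sim_value empty.prems by metis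
  have "val_rel clos (msubst \<sigma> M) (msubst \<sigma>' U')"
    using val_rel_clos U'(2) empty.prems(2) by blast
  moreover have "step\<^sup>*\<^sup>* (msubst \<sigma>' M') (msubst \<sigma>' U')"
    using steps_msubst[OF U'(1)] env_sim_value_subst[OF empty.prems(2)] by blast
  ultimately show ?case
    using nf_match_value value_no_step val_rel_value unfolding clos_progress_def by fastforce
next
  case (push E E' K K')
  obtain U' where U': "step\<^sup>*\<^sup>* M' U'" "val_rel sim M U'" using sim_value push.prems by metis
  have K: "stack_sim (ectx_comp K E) (ectx_comp K' E')" using stack_sim.push push.hyps by blast
  have "finite B" using push.prems(2) unfolding env_sim_def by blast
  then obtain y where y: "sim (plug E (FVar y)) (plug E' (FVar y))"
    and fresh: "y \<notin> B \<union> fv M \<union> fv U' \<union> fv_ectx E \<union> fv_ectx E' \<union> fv_ectx K \<union> fv_ectx K'"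
    using ectx_rel_fresh[OF push.hyps(1),
        of "B \<union> fv M \<union> fv U' \<union> fv_ectx E \<union> fv_ectx E' \<union> fv_ectx K \<union> fv_ectx K'"] by auto
  let ?r = "r(y := (case M of FVar z \<Rightarrow> Suc (r z) | _ \<Rightarrow> 0))"
  let ?\<sigma> = "\<sigma>(y := msubst \<sigma> M)" and ?\<sigma>' = "\<sigma>'(y := msubst \<sigma>' U')"
  have env: "env_sim (insert y A) (insert y (B \<union> fv M \<union> fv U')) ?r ?\<sigma> ?\<sigma>'"
    using env_sim_extend[OF push.prems(2) U'(2)] fresh by auto
  have T: "msubst \<sigma> (plug (ectx_comp K E) M) = msubst ?\<sigma> (plug K (plug E (FVar y)))"
    and T': "msubst \<sigma>' (plug (ectx_comp K' E') U') = msubst ?\<sigma>' (plug K' (plug E' (FVar y)))"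
    using fresh by simp_all
  have "clos_progress (msubst ?\<sigma> (plug K (plug E (FVar y)))) (msubst ?\<sigma>' (plug K' (plug E' (FVar y))))"
  proof (cases "is_value (plug E (FVar y))")
    case True
    then show ?thesis using push.IH[OF y env] by blast
  next
    case False
    then show ?thesis using clos_progress_nonvalue[OF y push.hyps(2) env] by blast
  qed
  moreover have "step\<^sup>*\<^sup>* (msubst \<sigma>' (plug (ectx_comp K' E') M')) (msubst \<sigma>' (plug (ectx_comp K' E') U'))"
    using steps_state[OF U'(1)] stack_sim_wf[OF K] env_sim_value_subst[OF push.prems(2)] by blast
  ultimately show ?case
    using clos_progress_expand lc_state(2)[OF push.prems(1) K push.prems(2)] unfolding T T' by blast
qed

lemma sim_clos:
  assumes "clos T T'"
  shows "sim T T'"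
  using _ assms
proof (rule sim_simulation[of clos])
  fix T T' assume "clos T T'"
  then obtain M M' K K' A B r \<sigma> \<sigma>' where st: "sim M M'" "stack_sim K K'" "env_sim A B r \<sigma> \<sigma>'"
    and T: "T = msubst \<sigma> (plug K M)" and T': "step\<^sup>*\<^sup>* T' (msubst \<sigma>' (plug K' M'))" "lc T'"
    unfolding clos_def by blast
  have "clos_progress T (msubst \<sigma>' (plug K' M'))"
    unfolding T using clos_progress_value clos_progress_nonvalue st by blast
  then have "clos_progress T T'" using clos_progress_expand T' by blast
  moreover have "lc T" using T lc_state(1)[OF st] by simp
  ultimately show "lc T \<and> lc T' \<and> (\<forall>N. T \<rightarrow>\<^sub>v N \<longrightarrow> clos N T') \<and> nf_match clos T T'"
    using T'(2) unfolding clos_progress_def by blast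
qed

section \<open>Congruence rules as instances of the closure\<close>

lemma val_rel_sim_refl: "is_value V \<Longrightarrow> lc V \<Longrightarrow> val_rel sim V V"
  unfolding val_rel_def by (simp add: sim_refl exI[of _ "{}"])

text \<open>The instance of \<open>clos\<close> with empty stack and the single binding of
  \<open>x\<close> to \<open>y\<close>. The case \<open>x = y\<close> is separate because a new
  binding must not mention its own variable.\<close>

lemma sim_subst_var:
  assumes "sim M M'"
  shows "sim (subst M x (FVar y)) (subst M' x (FVar y))"
proof (cases "x = y")
  case True
  then show ?thesis using assms msubst_FVar_upd[of x "FVar y"] by (simp add: fun_upd_idem)
next
  case False
  then have "env_sim (insert x {}) (insert x ({y} \<union> fv (FVar y) \<union> fv (FVar y)))
      ((\<lambda>_. 0)(x := (case FVar y of FVar z \<Rightarrow> Suc 0 | _ \<Rightarrow> 0)))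
      (FVar(x := msubst FVar (FVar y))) (FVar(x := msubst FVar (FVar y)))"
    by (intro env_sim_extend val_rel_sim_refl) (auto simp: env_sim_def)
  from sim_clos[OF closI[OF assms stack_sim.empty this]] show ?thesis
    by (simp add: msubst_FVar_upd)
qed

lemma sim_plug:
  assumes "sim M M'" "ectx_rel sim E E'"
  shows "sim (plug E M) (plug E' M')"
  using sim_clos[OF closI[OF assms(1) stack_sim.push[OF assms(2) stack_sim.empty] env_sim_empty]]
  by simp

text \<open>Two pluggings: first the arguments behind a variable head, which relates the contexts
  applying the hole to \<open>N\<close> and \<open>N'\<close>; then the functions into these
  contexts.\<close>

lemma sim_App:
  assumes "sim M M'" "sim N N'"
  shows "sim (App M N) (App M' N')"
proof -
  have "sim (App (FVar z) N) (App (FVar z) N')" for z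
  proof -
    have "ectx_rel sim (EArg (FVar z) EHole) (EArg (FVar z) EHole)"
      unfolding ectx_rel_def by (simp add: sim_refl exI[of _ "{}"])
    from sim_plug[OF assms(2) this] show ?thesis by simp
  qed
  then have "ectx_rel sim (EFun EHole N) (EFun EHole N')"
    unfolding ectx_rel_def by (simp add: exI[of _ "{}"])
  from sim_plug[OF assms(1) this] show ?thesis by simp
qed

text \<open>Both sides are values, so only their applications to a variable matter. These
  beta-reduce to renamed bodies, related by \<open>sim_subst_var\<close>, and \<open>sim\<close> is
  closed under prepending steps on either side.\<close>

lemma sim_lam:
  assumes "sim M M'"
  shows "sim (lam x M) (lam x M')"
proof -
  have lc: "lc M" "lc M'" using sim_lc[OF assms] by auto
  have "sim (App (lam x M) (FVar y)) (App (lam x M') (FVar y))" for y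
  proof -
    have b: "App (lam x M) (FVar y) \<rightarrow>\<^sub>v subst M x (FVar y)"
      "App (lam x M') (FVar y) \<rightarrow>\<^sub>v subst M' x (FVar y)"
      using beta_lam lc by auto
    from sim_expand[OF r_into_rtranclp[of step, OF b(2)] sim_subst_var[OF assms]] lc
    have "sim (subst M x (FVar y)) (App (lam x M') (FVar y))" by (simp add: lc_lam)
    from sim_left_expand[OF b(1) this] lc show ?thesis by (simp add: lc_lam)
  qed
  then have "val_rel sim (lam x M) (lam x M')"
    unfolding val_rel_def by (simp add: exI[of _ "{}"] lam_def)
  then have "nf_match sim (lam x M) (lam x M')"
    by (rule nf_match_value[OF rtranclp.rtrancl_refl])
  moreover have "\<not> lam x M \<rightarrow>\<^sub>v N" for N by (simp add: lam_def value_no_step)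
  ultimately show ?thesis using lc by (intro sim.intros) (simp_all add: lc_lam)
qed

lemma sim_fill: "sim M M' \<Longrightarrow> lc_ctx C \<Longrightarrow> sim (fill C M) (fill C M')"
  by (induction C) (auto intro: sim_lam sim_App sim_refl)

text \<open>Renaming carries the relation from one fresh \<open>z\<close> to any \<open>y\<close>.
  In a trace \<open>y\<close> is chosen by Opponent and may lie in the finite set excluded by
  \<open>val_rel\<close>.\<close>

lemma val_rel_sim_var:
  assumes "val_rel sim V V'"
  shows "sim (App V (FVar y)) (App V' (FVar y))"
proof -
  obtain z where z: "sim (App V (FVar z)) (App V' (FVar z))" "z \<notin> fv V \<union> fv V'"
    using val_rel_fresh[OF assms, of "fv V \<union> fv V'"] by auto
  with sim_subst_var[OF z(1), of z y] show ?thesis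
    by (simp flip: msubst_FVar_upd)
qed

lemma ectx_rel_sim_var:
  assumes "ectx_rel sim E E'"
  shows "sim (plug E (FVar y)) (plug E' (FVar y))"
  using sim_plug[OF sim_refl assms] by simp

section \<open>Traces\<close>

abbreviation trace_names :: "action list \<Rightarrow> name set" where
  "trace_names s \<equiv> \<Union>a\<in>set s. bound_names a"

lemma Nil_in_traces [simp]: "[] \<in> traces F"
  unfolding traces_def using performs.refl by blast

lemma traces_visible: "aogs F a F' \<Longrightarrow> a \<noteq> Tau \<Longrightarrow> s \<in> traces F' \<Longrightarrow> a # s \<in> traces F"
  unfolding traces_def using performs.visible by blast

lemma traces_steps:
  assumes "step\<^sup>*\<^sup>* M N" "s \<in> traces (Active N p \<gamma> \<phi>)"
  shows "s \<in> traces (Active M p \<gamma> \<phi>)"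
  using assms
proof (induction rule: converse_rtranclp_induct)
  case (step M N)
  then show ?case unfolding traces_def using performs.tau[OF aogs.P_tau] by blast
qed

lemma traces_ActiveE:
  assumes "a # s \<in> traces (Active M p \<gamma> \<phi>)"
  obtains N F where "step\<^sup>*\<^sup>* M N" "aogs (Active N p \<gamma> \<phi>) a F" "a \<noteq> Tau" "s \<in> traces F"
proof -
  from assms obtain G where "performs (Active M p \<gamma> \<phi>) (a # s) G" unfolding traces_def by blast
  then have "\<exists>N F. step\<^sup>*\<^sup>* M N \<and> aogs (Active N p \<gamma> \<phi>) a F \<and> a \<noteq> Tau \<and> s \<in> traces F"
  proof (induction "Active M p \<gamma> \<phi>" "a # s" G arbitrary: M rule: performs.induct)
    case (tau F' G)
    from tau.hyps(1) obtain N where "M \<rightarrow>\<^sub>v N" "F' = Active N p \<gamma> \<phi>" by cases auto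
    with tau.hyps(3) obtain N' F where "step\<^sup>*\<^sup>* N N'"
      "aogs (Active N' p \<gamma> \<phi>) a F \<and> a \<noteq> Tau \<and> s \<in> traces F" by blast
    with converse_rtranclp_into_rtranclp[of step, OF \<open>M \<rightarrow>\<^sub>v N\<close>] show ?case by blast
  next
    case visible
    then show ?case unfolding traces_def by blast
  qed
  with that show thesis by blast
qed

lemma traces_PassiveE:
  assumes "a # s \<in> traces (Passive \<gamma> \<phi>)"
  obtains F where "aogs (Passive \<gamma> \<phi>) a F" "a \<noteq> Tau" "s \<in> traces F"
proof -
  from assms obtain G where "performs (Passive \<gamma> \<phi>) (a # s) G" unfolding traces_def by blast
  then show thesis
  proof cases
    case (tau F')
    from tau(1) show thesis by cases
  next
    case (visible F')
    then show thesis by (intro that[of F']) (auto simp: traces_def)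
  qed
qed

section \<open>Trace sets described by their first action\<close>

lemma traces_PAns:
  "PAns q x # s \<in> traces (Active M p \<gamma> \<phi>) \<longleftrightarrow>
     q = p \<and> VName x \<notin> \<phi> \<and> VName x \<notin> dom \<gamma> \<and>
     (\<exists>V. step\<^sup>*\<^sup>* M V \<and> is_value V \<and>
       s \<in> traces (Passive (\<gamma>(VName x \<mapsto> Val V)) (\<phi> \<union> {VName x})))" (is "?l \<longleftrightarrow> ?r")
proof
  assume ?l
  then obtain N F where "step\<^sup>*\<^sup>* M N" "aogs (Active N p \<gamma> \<phi>) (PAns q x) F" "s \<in> traces F"
    by (rule traces_ActiveE)
  from this(2,1,3) show ?r by cases auto
next
  assume ?r
  then obtain V where V: "step\<^sup>*\<^sup>* M V" "aogs (Active V p \<gamma> \<phi>) (PAns q x)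
      (Passive (\<gamma>(VName x \<mapsto> Val V)) (\<phi> \<union> {VName x}))"
    "s \<in> traces (Passive (\<gamma>(VName x \<mapsto> Val V)) (\<phi> \<union> {VName x}))"
    using aogs.PA by blast
  then show ?l using traces_steps[OF V(1)] traces_visible by blast
qed

lemma traces_PQue:
  "PQue x y q # s \<in> traces (Active M p \<gamma> \<phi>) \<longleftrightarrow>
     {VName y, CName q} \<inter> \<phi> = {} \<and> {VName y, CName q} \<inter> dom \<gamma> = {} \<and>
     (\<exists>E V. step\<^sup>*\<^sup>* M (plug E (App (FVar x) V)) \<and> is_ectx E \<and> is_value V \<and>
       s \<in> traces (Passive (\<gamma>(VName y \<mapsto> Val V, CName q \<mapsto> Cont E p)) (\<phi> \<union> {VName y, CName q})))"
  (is "?l \<longleftrightarrow> ?r")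
proof
  assume ?l
  then obtain N F where "step\<^sup>*\<^sup>* M N" "aogs (Active N p \<gamma> \<phi>) (PQue x y q) F" "s \<in> traces F"
    by (rule traces_ActiveE)
  from this(2,1,3) show ?r
  proof cases
    case (PQ E V)
    with \<open>step\<^sup>*\<^sup>* M N\<close> \<open>s \<in> traces F\<close> show ?thesis
      by (intro conjI exI[of _ E] exI[of _ V]) simp_all
  qed
next
  assume r: ?r
  then obtain E V where V: "step\<^sup>*\<^sup>* M (plug E (App (FVar x) V))" "is_ectx E" "is_value V"
    "s \<in> traces (Passive (\<gamma>(VName y \<mapsto> Val V, CName q \<mapsto> Cont E p)) (\<phi> \<union> {VName y, CName q}))"
    by (elim conjE exE) (rule that)
  from aogs.PQ[OF V(2,3) r[THEN conjunct1] r[THEN conjunct2, THEN conjunct1]] have "PQue x y q # s \<in> traces (Active (plug E (App (FVar x) V)) p \<gamma> \<phi>)"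
    by (rule traces_visible) (use V(4) in simp_all)
  then show ?l by (rule traces_steps[OF V(1)])
qed

text \<open>Rule \<open>OA\<close> presents the environment as an extension by \<open>q\<close>;
  read backwards, it erases \<open>q\<close>, so the continuation is consumed by its answer.\<close>

lemma traces_OAns:
  "OAns q x # s \<in> traces (Passive \<gamma> \<phi>) \<longleftrightarrow> VName x \<notin> \<phi> \<and>
     (\<exists>E p. \<gamma> (CName q) = Some (Cont E p) \<and>
       s \<in> traces (Active (plug E (FVar x)) p (\<gamma>(CName q := None)) (\<phi> \<union> {VName x})))"
  (is "?l \<longleftrightarrow> ?r")
proof
  assume ?l
  then obtain F where "aogs (Passive \<gamma> \<phi>) (OAns q x) F" "s \<in> traces F"
    by (rule traces_PassiveE)
  then show ?r
  proof cases
    case (OA \<delta> E p)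
    then have "\<gamma> (CName q) = Some (Cont E p)" "\<delta> = \<gamma>(CName q := None)" "VName x \<notin> \<phi>"
      "s \<in> traces (Active (plug E (FVar x)) p \<delta> (\<phi> \<union> {VName x}))"
      using \<open>s \<in> traces F\<close> by (simp_all add: domIff fun_upd_idem)
    then show ?thesis by (intro conjI exI[of _ E] exI[of _ p]) simp_all
  qed
next
  assume ?r
  then obtain E p where "\<gamma> (CName q) = Some (Cont E p)" and x: "VName x \<notin> \<phi>"
    and s: "s \<in> traces (Active (plug E (FVar x)) p (\<gamma>(CName q := None)) (\<phi> \<union> {VName x}))"
    by blast
  then have "aogs (Passive \<gamma> \<phi>) (OAns q x)
      (Active (plug E (FVar x)) p (\<gamma>(CName q := None)) (\<phi> \<union> {VName x}))"
    using aogs.OA[of q "\<gamma>(CName q := None)" x \<phi> E p] by (simp add: fun_upd_idem)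
  with s show ?l by (intro traces_visible) simp_all
qed

lemma traces_OQue:
  "OQue x y p # s \<in> traces (Passive \<gamma> \<phi>) \<longleftrightarrow> {VName y, CName p} \<inter> \<phi> = {} \<and>
     (\<exists>V. \<gamma> (VName x) = Some (Val V) \<and>
       s \<in> traces (Active (App V (FVar y)) p \<gamma> (\<phi> \<union> {VName y, CName p})))"
  (is "?l \<longleftrightarrow> ?r")
proof
  assume ?l
  then obtain F where "aogs (Passive \<gamma> \<phi>) (OQue x y p) F" "s \<in> traces F"
    by (rule traces_PassiveE)
  then show ?r
  proof cases
    case (OQ V)
    with \<open>s \<in> traces F\<close> show ?thesis by (intro conjI exI[of _ V]) simp_all
  qed
next
  assume r: ?r
  then obtain V where V: "\<gamma> (VName x) = Some (Val V)"
    "s \<in> traces (Active (App V (FVar y)) p \<gamma> (\<phi> \<union> {VName y, CName p}))"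
    by (elim conjE exE) (rule that)
  from aogs.OQ[of \<gamma> x, OF V(1) r[THEN conjunct1]] show ?l
    by (rule traces_visible) (use V(2) in simp_all)
qed

lemma traces_Initial:
  "a # s \<in> traces (Initial M \<phi>) \<longleftrightarrow> (\<exists>p. a = IOQue p \<and> CName p \<notin> \<phi> \<and>
     s \<in> traces (Active M p Map.empty (\<phi> \<union> {CName p})))" (is "?l \<longleftrightarrow> ?r")
proof
  assume ?l
  then obtain G where "performs (Initial M \<phi>) (a # s) G" unfolding traces_def by blast
  then show ?r
  proof cases
    case (tau F')
    from tau(1) show ?r by cases
  next
    case (visible F')
    from visible(2) show ?r by cases (use visible(3) in \<open>auto simp: traces_def\<close>)
  qed
next
  assume ?r
  then obtain p where p: "a = IOQue p" "CName p \<notin> \<phi>"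
    "s \<in> traces (Active M p Map.empty (\<phi> \<union> {CName p}))" by (elim conjE exE) (rule that)
  from aogs.IOQ[OF p(2)] show ?l
    unfolding p(1) by (rule traces_visible) (use p(3) in simp_all)
qed

section \<open>Similarity implies trace inclusion\<close>

text \<open>Related contexts return to the same name \<open>p\<close>, since a later answer at
  \<open>p\<close> is visible in the trace.\<close>

inductive entry_sim :: "entry \<Rightarrow> entry \<Rightarrow> bool" where
  "val_rel sim V V' \<Longrightarrow> entry_sim (Val V) (Val V')"
| "ectx_rel sim E E' \<Longrightarrow> entry_sim (Cont E p) (Cont E' p)"

inductive_cases entry_sim_ValE: "entry_sim (Val V) e"
inductive_cases entry_sim_ContE: "entry_sim (Cont E p) e"

abbreviation store_sim :: "env \<Rightarrow> env \<Rightarrow> bool" where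
  "store_sim \<gamma> \<gamma>' \<equiv> \<forall>n. rel_option entry_sim (\<gamma> n) (\<gamma>' n)"

lemma store_sim_dom:
  assumes "store_sim \<gamma> \<gamma>'"
  shows "dom \<gamma>' = dom \<gamma>"
proof (rule set_eqI)
  fix n
  show "n \<in> dom \<gamma>' \<longleftrightarrow> n \<in> dom \<gamma>"
    using spec[OF assms, of n] by (cases "\<gamma> n"; cases "\<gamma>' n") (simp_all add: dom_def)
qed

lemma store_sim_upd: "store_sim \<gamma> \<gamma>' \<Longrightarrow> entry_sim e e' \<Longrightarrow> store_sim (\<gamma>(n \<mapsto> e)) (\<gamma>'(n \<mapsto> e'))"
  by simp

text \<open>The name sets may differ, for instance when the right term has more free variables.
  \<open>X\<close> bounds the excess on the right, and bound names that avoid it and are fresh on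
  the left are fresh on the right.\<close>

inductive config_sim :: "name set \<Rightarrow> config \<Rightarrow> config \<Rightarrow> bool" for X where
  act: "sim M M' \<Longrightarrow> store_sim \<gamma> \<gamma>' \<Longrightarrow> \<phi>' \<subseteq> \<phi> \<union> X \<Longrightarrow>
     config_sim X (Active M p \<gamma> \<phi>) (Active M' p \<gamma>' \<phi>')"
| pas: "store_sim \<gamma> \<gamma>' \<Longrightarrow> \<phi>' \<subseteq> \<phi> \<union> X \<Longrightarrow>
     config_sim X (Passive \<gamma> \<phi>) (Passive \<gamma>' \<phi>')"

lemma sim_steps: "step\<^sup>*\<^sup>* M N \<Longrightarrow> sim M M' \<Longrightarrow> sim N M'"
  by (induction rule: rtranclp_induct) (auto intro: sim_step)

text \<open>Silent steps on the left do not move the right partner (\<open>sim_steps\<close>). A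
  Proponent action exhibits a normal form on the left, and \<open>sim\<close> supplies a reduction
  on the right to a matching one; an Opponent action resumes related entries at the variable given
  by the trace.\<close>

lemma config_sim_traces:
  assumes "s \<in> traces F" "config_sim X F F'" "trace_names s \<inter> X = {}"
  shows "s \<in> traces F'"
  using assms
proof (induction s arbitrary: F F')
  case (Cons a s)
  have names: "bound_names a \<inter> X = {}" "trace_names s \<inter> X = {}" using Cons.prems(3) by auto
  from Cons.prems(2) show ?case
  proof cases
    case (act M M' \<gamma> \<gamma>' \<phi>' \<phi> p)
    note dom = store_sim_dom[OF act(4)]
    from Cons.prems(1) act(1) obtain N G where
      "aogs (Active N p \<gamma> \<phi>) a G" "a \<noteq> Tau" by (metis traces_ActiveE)
    then consider q x where "a = PAns q x" | x y q where "a = PQue x y q" by cases auto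
    then show ?thesis
    proof cases
      case (1 q x)
      with Cons.prems(1) act(1) obtain V where V: "q = p" "VName x \<notin> \<phi>" "VName x \<notin> dom \<gamma>"
        "step\<^sup>*\<^sup>* M V" "is_value V"
        "s \<in> traces (Passive (\<gamma>(VName x \<mapsto> Val V)) (\<phi> \<union> {VName x}))"
        by (auto simp: traces_PAns)
      obtain V' where V': "step\<^sup>*\<^sup>* M' V'" "val_rel sim V V'"
        using sim_value[OF sim_steps[OF V(4) act(3)] V(5)] .
      have "config_sim X (Passive (\<gamma>(VName x \<mapsto> Val V)) (\<phi> \<union> {VName x}))
          (Passive (\<gamma>'(VName x \<mapsto> Val V')) (\<phi>' \<union> {VName x}))"
        by (intro config_sim.pas store_sim_upd entry_sim.intros) (use act V' in auto)
      from Cons.IH[OF V(6) this names(2)] V V' dom names act 1 show ?thesis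
        by (auto simp: traces_PAns val_rel_def)
    next
      case (2 x y q)
      from Cons.prems(1)[unfolded act(1) 2 traces_PQue] obtain E V where V:
        "{VName y, CName q} \<inter> \<phi> = {}" "{VName y, CName q} \<inter> dom \<gamma> = {}"
        "step\<^sup>*\<^sup>* M (plug E (App (FVar x) V))" "is_ectx E" "is_value V"
        "s \<in> traces (Passive (\<gamma>(VName y \<mapsto> Val V, CName q \<mapsto> Cont E p)) (\<phi> \<union> {VName y, CName q}))"
        by (elim conjE exE) (rule that)
      obtain E' V' where V': "step\<^sup>*\<^sup>* M' (plug E' (App (FVar x) V'))"
        "ectx_rel sim E E'" "val_rel sim V V'"
        using sim_stuck[OF sim_steps[OF V(3) act(3)] V(4,5)] .
      have "config_sim X
          (Passive (\<gamma>(VName y \<mapsto> Val V, CName q \<mapsto> Cont E p)) (\<phi> \<union> {VName y, CName q}))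
          (Passive (\<gamma>'(VName y \<mapsto> Val V', CName q \<mapsto> Cont E' p)) (\<phi>' \<union> {VName y, CName q}))"
        by (intro config_sim.pas store_sim_upd entry_sim.intros) (use act V' in auto)
      note IH = Cons.IH[OF V(6) this names(2)]
      have "{VName y, CName q} \<inter> \<phi>' = {}" "{VName y, CName q} \<inter> dom \<gamma>' = {}"
        using V(1,2) dom names(1) act(5) 2 by auto
      with IH V'(1) ectx_rel_ectx[OF V'(2)] val_rel_value[OF V'(3)] show ?thesis
        unfolding 2 act(2) traces_PQue by (intro conjI exI[of _ E'] exI[of _ V']) simp_all
    qed
  next
    case (pas \<gamma> \<gamma>' \<phi>' \<phi>)
    from Cons.prems(1) pas(1) obtain G where
      "aogs (Passive \<gamma> \<phi>) a G" "a \<noteq> Tau" by (metis traces_PassiveE)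
    then consider q x where "a = OAns q x" | x y q where "a = OQue x y q" by cases auto
    then show ?thesis
    proof cases
      case (1 q x)
      with Cons.prems(1) pas(1) obtain E p where E: "VName x \<notin> \<phi>"
        "\<gamma> (CName q) = Some (Cont E p)"
        "s \<in> traces (Active (plug E (FVar x)) p (\<gamma>(CName q := None)) (\<phi> \<union> {VName x}))"
        by (auto simp: traces_OAns)
      obtain E' where E': "\<gamma>' (CName q) = Some (Cont E' p)" "ectx_rel sim E E'"
        using pas(3) E(2) by (metis entry_sim_ContE option_rel_Some1)
      have "config_sim X (Active (plug E (FVar x)) p (\<gamma>(CName q := None)) (\<phi> \<union> {VName x}))
          (Active (plug E' (FVar x)) p (\<gamma>'(CName q := None)) (\<phi>' \<union> {VName x}))"
        by (intro config_sim.act ectx_rel_sim_var) (use pas E' in auto)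
      from Cons.IH[OF E(3) this names(2)] E E' names pas 1 show ?thesis
        by (auto simp: traces_OAns)
    next
      case (2 x y q)
      from Cons.prems(1)[unfolded pas(1) 2 traces_OQue] obtain V where V: "{VName y, CName q} \<inter> \<phi> = {}"
        "\<gamma> (VName x) = Some (Val V)"
        "s \<in> traces (Active (App V (FVar y)) q \<gamma> (\<phi> \<union> {VName y, CName q}))"
        by (elim conjE exE) (rule that)
      obtain V' where V': "\<gamma>' (VName x) = Some (Val V')" "val_rel sim V V'"
        using pas(3) V(2) by (metis entry_sim_ValE option_rel_Some1)
      have "config_sim X (Active (App V (FVar y)) q \<gamma> (\<phi> \<union> {VName y, CName q}))
          (Active (App V' (FVar y)) q \<gamma>' (\<phi>' \<union> {VName y, CName q}))"
        by (intro config_sim.act val_rel_sim_var) (use pas V' in auto)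
      note IH = Cons.IH[OF V(3) this names(2)]
      have "{VName y, CName q} \<inter> \<phi>' = {}" using V(1) names(1) pas(4) 2 by auto
      with IH V'(1) show ?thesis
        unfolding 2 pas(2) traces_OQue by (intro conjI exI[of _ V'])
    qed
  qed
qed simp

lemma sim_traces_Initial:
  assumes "sim M M'" "s \<in> traces (Initial M \<phi>)" "trace_names s \<inter> \<phi>' = {}"
  shows "s \<in> traces (Initial M' \<phi>')"
proof (cases s)
  case (Cons a t)
  with assms(2) obtain p where p: "a = IOQue p"
    "t \<in> traces (Active M p Map.empty (\<phi> \<union> {CName p}))" by (auto simp: traces_Initial)
  \<comment> \<open>Choosing the whole right name set for \<open>X\<close> makes the inclusion
    trivial, and the trace avoids it by assumption.\<close>
  have "config_sim \<phi>' (Active M p Map.empty (\<phi> \<union> {CName p}))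
      (Active M' p Map.empty (\<phi>' \<union> {CName p}))"
    by (intro config_sim.act assms(1)) auto
  from config_sim_traces[OF p(2) this] assms(3) p(1) Cons show ?thesis
    by (auto simp: traces_Initial)
qed simp

section \<open>Trace inclusion implies similarity\<close>

definition fresh_traces_le :: "config \<Rightarrow> config \<Rightarrow> bool" where
  "fresh_traces_le F F' \<longleftrightarrow> (\<forall>s. trace_names s \<inter> (config_names F \<union> config_names F') = {} \<longrightarrow>
     s \<in> traces F \<longrightarrow> s \<in> traces F')"

text \<open>The environments are existential because play adds entries to them. Their domains lie in
  finite name sets, so names that can be bound on both sides always exist.\<close>

definition traces_rel :: "trm \<Rightarrow> trm \<Rightarrow> bool" where
  "traces_rel M M' \<longleftrightarrow> lc M \<and> lc M' \<and> (\<exists>p \<gamma> \<gamma>' \<phi> \<phi>'. finite \<phi> \<and> finite \<phi>' \<and>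
     dom \<gamma> \<subseteq> \<phi> \<and> dom \<gamma>' \<subseteq> \<phi>' \<and> fresh_traces_le (Active M p \<gamma> \<phi>) (Active M' p \<gamma>' \<phi>'))"

lemma fresh_var: "finite \<phi> \<Longrightarrow> \<exists>y. VName y \<notin> \<phi>"
  using ex_fresh[of "VName -` \<phi>"] by (auto simp: finite_vimageI inj_def)

lemma fresh_cname: "finite \<phi> \<Longrightarrow> \<exists>q. CName q \<notin> \<phi>"
  using ex_fresh[of "CName -` \<phi>"] by (auto simp: finite_vimageI inj_def)

lemma traces_relI:
  assumes "lc M" "lc M'" "finite \<phi>" "finite \<phi>'" "dom \<gamma> \<subseteq> \<phi>" "dom \<gamma>' \<subseteq> \<phi>'"
    and "\<And>s. trace_names s \<inter> (\<phi> \<union> \<phi>') = {} \<Longrightarrow> s \<in> traces (Active M p \<gamma> \<phi>) \<Longrightarrow>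
      s \<in> traces (Active M' p \<gamma>' \<phi>')"
  shows "traces_rel M M'"
  unfolding traces_rel_def fresh_traces_le_def config_names.simps using assms by blast

text \<open>The first Proponent action reveals the shape of a normal form, and the next Opponent
  move isolates one component: a value by a question, a context by an answer. Prefixing both actions
  turns a trace of a component into one of the whole configuration, to which the inclusion
  applies.\<close>

lemma traces_rel_nf_match:
  assumes "traces_rel M M'"
  shows "nf_match traces_rel M M'"
proof -
  from assms obtain p \<gamma> \<gamma>' \<phi> \<phi>' where lc: "lc M" "lc M'"
    and fin: "finite \<phi>" "finite \<phi>'" and dom: "dom \<gamma> \<subseteq> \<phi>" "dom \<gamma>' \<subseteq> \<phi>'"
    and le: "\<And>s. trace_names s \<inter> (\<phi> \<union> \<phi>') = {} \<Longrightarrow> s \<in> traces (Active M p \<gamma> \<phi>) \<Longrightarrow>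
      s \<in> traces (Active M' p \<gamma>' \<phi>')"
    unfolding traces_rel_def fresh_traces_le_def config_names.simps by blast
  \<comment> \<open>\<open>x\<close> and \<open>q\<close> are bound by the first action,
    \<open>r\<close> by a following question. Hence \<open>r\<close> avoids \<open>q\<close>, and
    the set \<open>L\<close> of excluded variables contains \<open>x\<close>.\<close>
  obtain x where x: "VName x \<notin> \<phi> \<union> \<phi>'" using fresh_var[of "\<phi> \<union> \<phi>'"] fin by blast
  obtain q where q: "CName q \<notin> \<phi> \<union> \<phi>'" using fresh_cname[of "\<phi> \<union> \<phi>'"] fin by blast
  obtain r where r: "CName r \<notin> insert (CName q) (\<phi> \<union> \<phi>')"
    using fresh_cname[of "insert (CName q) (\<phi> \<union> \<phi>')"] fin by blast
  define L where "L = insert x (VName -` (\<phi> \<union> \<phi>'))"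
  have L: "finite L" unfolding L_def using fin by (auto simp: finite_vimageI inj_def)
  show ?thesis
    unfolding nf_match_def
  proof (intro conjI impI allI)
    assume val: "is_value M"
    have "[PAns p x] \<in> traces (Active M p \<gamma> \<phi>)"
      using val x dom by (auto simp: traces_PAns)
    \<comment> \<open>The one-action trace already forces \<open>M'\<close> to converge, which fixes
      \<open>V'\<close> before any \<open>y\<close> or \<open>s\<close> is considered.\<close>
    with le[of "[PAns p x]"] x obtain V' where V': "step\<^sup>*\<^sup>* M' V'" "is_value V'"
      by (auto simp: traces_PAns)
    have "traces_rel (App M (FVar y)) (App V' (FVar y))" if y: "y \<notin> L" for y
    proof (rule traces_relI)
      fix s
      assume s: "trace_names s \<inter> (\<phi> \<union> {VName x} \<union> {VName y, CName r} \<union>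
          (\<phi>' \<union> {VName x} \<union> {VName y, CName r})) = {}"
        "s \<in> traces (Active (App M (FVar y)) r (\<gamma>(VName x \<mapsto> Val M))
          (\<phi> \<union> {VName x} \<union> {VName y, CName r}))"
      have "PAns p x # OQue x y r # s \<in> traces (Active M p \<gamma> \<phi>)"
        using val x y r dom s(2) unfolding traces_PAns traces_OQue L_def by fastforce
      then have "PAns p x # OQue x y r # s \<in> traces (Active M' p \<gamma>' \<phi>')"
        using x y r s(1) by (intro le) (auto simp: L_def)
      then obtain W where W: "step\<^sup>*\<^sup>* M' W" "is_value W"
        "s \<in> traces (Active (App W (FVar y)) r (\<gamma>'(VName x \<mapsto> Val W))
          (\<phi>' \<union> {VName x} \<union> {VName y, CName r}))"
        by (auto simp: traces_PAns traces_OQue)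
      \<comment> \<open>A priori the value reached on the right depends on the trace; determinism
        identifies it with \<open>V'\<close>.\<close>
      have "W = V'" using steps_normal_unique[OF W(1) V'(1)] W(2) V'(2) value_no_step by blast
      with W(3) show "s \<in> traces (Active (App V' (FVar y)) r (\<gamma>'(VName x \<mapsto> Val V'))
          (\<phi>' \<union> {VName x} \<union> {VName y, CName r}))" by simp
    qed (use lc lc_steps V' fin dom in auto)
    with val V' L show "\<exists>V'. step\<^sup>*\<^sup>* M' V' \<and> val_rel traces_rel M V'"
      unfolding val_rel_def by blast
  next
    fix E z V
    assume E: "is_ectx E" and V: "is_value V" and M: "M = plug E (App (FVar z) V)"
    let ?\<gamma> = "\<gamma>(VName x \<mapsto> Val V, CName q \<mapsto> Cont E p)" and ?\<phi> = "\<phi> \<union> {VName x, CName q}"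
    have M_trace: "PQue z x q # s \<in> traces (Active M p \<gamma> \<phi>)" if "s \<in> traces (Passive ?\<gamma> ?\<phi>)" for s
      unfolding traces_PQue M using that E V x q dom by blast
    from le[OF _ M_trace[of "[]"]] x q obtain E' V' where
      M': "step\<^sup>*\<^sup>* M' (plug E' (App (FVar z) V'))" "is_ectx E'" "is_value V'"
      by (auto simp: traces_PQue)
    let ?\<gamma>' = "\<gamma>'(VName x \<mapsto> Val V', CName q \<mapsto> Cont E' p)" and ?\<phi>' = "\<phi>' \<union> {VName x, CName q}"
    \<comment> \<open>Again the right side does not depend on the trace: the normal form is unique,
      and so is its decomposition into context and argument.\<close>
    have M'_trace: "s \<in> traces (Passive ?\<gamma>' ?\<phi>')"
      if "PQue z x q # s \<in> traces (Active M' p \<gamma>' \<phi>')" for s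
    proof -
      from that obtain F W where W: "step\<^sup>*\<^sup>* M' (plug F (App (FVar z) W))" "is_ectx F" "is_value W"
        "s \<in> traces (Passive (\<gamma>'(VName x \<mapsto> Val W, CName q \<mapsto> Cont F p)) ?\<phi>')"
        unfolding traces_PQue by blast
      have "plug F (App (FVar z) W) = plug E' (App (FVar z) V')"
        using steps_normal_unique[OF W(1) M'(1)] W(2,3) M'(2,3) stuck_no_step by blast
      then have "F = E' \<and> W = V'"
        using unique_decomposition[of F "FVar z" W E' "FVar z" V'] W(2,3) M'(2,3) by simp
      with W(4) show ?thesis by blast
    qed
    have lc': "lc_ectx E" "lc V" "lc_ectx E'" "lc V'"
      using lc(1) M lc_steps[OF M'(1) lc(2)] by simp_all
    have "traces_rel (App V (FVar y)) (App V' (FVar y))" if y: "y \<notin> L" for y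
    proof (rule traces_relI)
      fix s
      assume s: "trace_names s \<inter> (?\<phi> \<union> {VName y, CName r} \<union> (?\<phi>' \<union> {VName y, CName r})) = {}"
        "s \<in> traces (Active (App V (FVar y)) r ?\<gamma> (?\<phi> \<union> {VName y, CName r}))"
      have "OQue x y r # s \<in> traces (Passive ?\<gamma> ?\<phi>)"
        using y r s(2) x unfolding traces_OQue L_def by auto
      from le[OF _ M_trace[OF this]] have "PQue z x q # OQue x y r # s \<in> traces (Active M' p \<gamma>' \<phi>')"
        using x q y r s(1) by (auto simp: L_def)
      from M'_trace[OF this]
      show "s \<in> traces (Active (App V' (FVar y)) r ?\<gamma>' (?\<phi>' \<union> {VName y, CName r}))"
        by (auto simp: traces_OQue)
    qed (use lc' fin dom in auto)
    then have "val_rel traces_rel V V'" unfolding val_rel_def using V M' L by blast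
    moreover have "traces_rel (plug E (FVar y)) (plug E' (FVar y))" if y: "y \<notin> L" for y
    proof (rule traces_relI)
      fix s
      assume s: "trace_names s \<inter> (?\<phi> \<union> {VName y} \<union> (?\<phi>' \<union> {VName y})) = {}"
        "s \<in> traces (Active (plug E (FVar y)) p (?\<gamma>(CName q := None)) (?\<phi> \<union> {VName y}))"
      have "OAns q y # s \<in> traces (Passive ?\<gamma> ?\<phi>)"
        using y s(2) x unfolding traces_OAns L_def by auto
      from le[OF _ M_trace[OF this]] have "PQue z x q # OAns q y # s \<in> traces (Active M' p \<gamma>' \<phi>')"
        using x q y s(1) by (auto simp: L_def)
      from M'_trace[OF this]
      show "s \<in> traces (Active (plug E' (FVar y)) p (?\<gamma>'(CName q := None)) (?\<phi>' \<union> {VName y}))"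
        by (auto simp: traces_OAns)
    qed (use lc' fin dom in auto)
    then have "ectx_rel traces_rel E E'" unfolding ectx_rel_def using E M' L by blast
    ultimately show "\<exists>E' V'. step\<^sup>*\<^sup>* M' (plug E' (App (FVar z) V')) \<and>
        ectx_rel traces_rel E E' \<and> val_rel traces_rel V V'" using M'(1) by blast
  qed
qed

lemma traces_rel_sim:
  assumes "traces_rel M M'"
  shows "sim M M'"
  using _ assms
proof (rule sim_simulation[of traces_rel])
  fix M M' assume R: "traces_rel M M'"
  have "traces_rel N M'" if step: "M \<rightarrow>\<^sub>v N" for N
  proof -
    from R obtain p \<gamma> \<gamma>' \<phi> \<phi>' where lc: "lc M" "lc M'"
      and fin: "finite \<phi>" "finite \<phi>'" "dom \<gamma> \<subseteq> \<phi>" "dom \<gamma>' \<subseteq> \<phi>'"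
      and le: "\<And>s. trace_names s \<inter> (\<phi> \<union> \<phi>') = {} \<Longrightarrow> s \<in> traces (Active M p \<gamma> \<phi>) \<Longrightarrow>
        s \<in> traces (Active M' p \<gamma>' \<phi>')"
      unfolding traces_rel_def fresh_traces_le_def config_names.simps by blast
    show ?thesis
      using lc_step[OF step lc(1)] lc(2) fin
      by (rule traces_relI) (rule le, assumption, rule traces_steps[OF r_into_rtranclp[of step, OF step]])
  qed
  moreover have "lc M \<and> lc M'" using R unfolding traces_rel_def by (elim conjE) (intro conjI)
  ultimately show "lc M \<and> lc M' \<and> (\<forall>N. M \<rightarrow>\<^sub>v N \<longrightarrow> traces_rel N M') \<and> nf_match traces_rel M M'"
    using traces_rel_nf_match[OF R] by (intro conjI allI impI) simp_all
qed

text \<open>A name \<open>p\<close> fresh for both sides opens both runs by the same initial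
  question, after which the active configurations with empty environments witness
  \<open>traces_rel\<close>.\<close>

lemma fresh_traces_le_sim:
  assumes "lc M" "lc M'" "finite \<phi>" "finite \<phi>'"
    and le: "fresh_traces_le (Initial M \<phi>) (Initial M' \<phi>')"
  shows "sim M M'"
proof (rule traces_rel_sim)
  obtain p where p: "CName p \<notin> \<phi> \<union> \<phi>'" using fresh_cname[of "\<phi> \<union> \<phi>'"] assms by blast
  show "traces_rel M M'"
  proof (rule traces_relI)
    fix s
    assume s: "trace_names s \<inter> (\<phi> \<union> {CName p} \<union> (\<phi>' \<union> {CName p})) = {}"
      "s \<in> traces (Active M p Map.empty (\<phi> \<union> {CName p}))"
    have "IOQue p # s \<in> traces (Initial M \<phi>)" using s(2) p by (simp add: traces_Initial)
    then have "IOQue p # s \<in> traces (Initial M' \<phi>')"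
      using le s(1) p unfolding fresh_traces_le_def by auto
    then show "s \<in> traces (Active M' p Map.empty (\<phi>' \<union> {CName p}))"
      by (simp add: traces_Initial)
  qed (use assms in auto)
qed

lemma sim_fresh_traces_le: "sim M M' \<Longrightarrow> fresh_traces_le (Initial M \<phi>) (Initial M' \<phi>')"
  unfolding fresh_traces_le_def
proof (intro allI impI)
  fix s
  assume s: "sim M M'" "s \<in> traces (Initial M \<phi>)"
    "trace_names s \<inter> (config_names (Initial M \<phi>) \<union> config_names (Initial M' \<phi>')) = {}"
  from s(3) have "trace_names s \<inter> \<phi>' = {}" unfolding config_names.simps by blast
  with s(1,2) show "s \<in> traces (Initial M' \<phi>')" by (rule sim_traces_Initial)
qed

section \<open>Trace equivalence as mutual similarity\<close>

lemma trace_equiv_iff: "F \<simeq>\<^sub>A G \<longleftrightarrow> fresh_traces_le F G \<and> fresh_traces_le G F"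
  unfolding trace_equiv_def fresh_traces_le_def by (auto simp: Un_commute)

lemma trace_equiv_init_config:
  assumes "lc M" "lc N"
  shows "init_config M \<simeq>\<^sub>A init_config N \<longleftrightarrow> sim M N \<and> sim N M"
proof
  assume "init_config M \<simeq>\<^sub>A init_config N"
  then have "fresh_traces_le (Initial M (VName ` fv M)) (Initial N (VName ` fv N))"
    "fresh_traces_le (Initial N (VName ` fv N)) (Initial M (VName ` fv M))"
    unfolding trace_equiv_iff init_config_def by simp_all
  from fresh_traces_le_sim[OF assms _ _ this(1)] fresh_traces_le_sim[OF assms(2,1) _ _ this(2)]
  show "sim M N \<and> sim N M" by simp
next
  assume "sim M N \<and> sim N M"
  then have "sim M N" "sim N M" by simp_all
  then show "init_config M \<simeq>\<^sub>A init_config N"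
    unfolding trace_equiv_iff init_config_def
    by (simp add: sim_fresh_traces_le)
qed

theorem theorem9p3:
  fixes M N :: trm
  assumes "lc M" and "lc N"
    and "init_config M \<simeq>\<^sub>A init_config N"
  shows "\<forall>C. lc_ctx C \<longrightarrow> init_config (fill C M) \<simeq>\<^sub>A init_config (fill C N)"
proof (intro allI impI)
  fix C assume C: "lc_ctx C"
  have "sim M N" "sim N M"
    using assms(3) unfolding trace_equiv_init_config[OF assms(1,2)] by simp_all
  note sim = this[THEN sim_fill, OF C]
  have lc: "lc (fill C M)" "lc (fill C N)" using sim_lc[OF sim(1)] by simp_all
  show "init_config (fill C M) \<simeq>\<^sub>A init_config (fill C N)"
    unfolding trace_equiv_init_config[OF lc] using sim by (rule conjI)
qed

end
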